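(* For every $\nu>0$, $\eta>0$ and $T>0$ there exist a smooth, zero-average, divergence-free vector field $b_0:\mathbb{T}^2\to\mathbb{R}^2$ and a couple $(f_1,f_2)$ of smooth (possibly time-dependent) vector fields $f_1,f_2:[0,\infty)\times\mathbb{T}^2\to\mathbb{R}^2$ with zero average, such that: (i) there exists a unique zero-average global smooth solution $(u,b)$ of the MHD equations on $\mathbb{T}^2$ with viscosity $\nu$, resistivity $\eta$, forces $(f_1,f_2)$ and initial datum $(u(0,\cdot),b(0,\cdot))=(0,b_0)$; (ii) the magnetic lines at time $t=0$ and at time $t=T$ are not topologically equivalent, i.e. there is no homeomorphism of $\mathbb{T}^2$ onto itself mapping the integral lines of $b(0,\cdot)$ onto the integral lines of $b(T,\cdot)$.
   Context: $\mathbb{T}^2=(\mathbb{R}/2\pi\mathbb{Z})^2$ is the two-dimensional flat torus. The (incompressible) MHD equations with viscosity $\nu$, resistivity $\eta$ and forces $(f_1,f_2)$ are $$\begin{cases} \partial_t u+(u\cdot \nabla)u+\nabla P=\nu\Delta u+(b\cdot \nabla)b+f_1,\\ \partial_t b+(u\cdot \nabla)b=(b\cdot \nabla)u+\eta\Delta b+f_2,\\ \operatorname{div} u=\operatorname{div} b=0,\\ u(0,\cdot)=u_0,\quad b(0,\cdot)=b_0, \end{cases}$$ where the unknowns are the velocity $u:[0,\infty)\times\mathbb{T}^2\to\mathbb{R}^2$, the magnetic field $b:[0,\infty)\times\mathbb{T}^2\to\mathbb{R}^2$ and the scalar pressure $P:[0,\infty)\times\mathbb{T}^2\to\mathbb{R}$.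 A solution is denoted $(u,b)$, the pressure (determined up to an additive function of time) being understood. Global means defined for all $t\ge 0$. A vector field on $\mathbb{T}^2$ has zero average if its integral over $\mathbb{T}^2$ is zero; for time-dependent fields this is required at every time $t\ge0$. The magnetic lines at time $t$ are the integral lines (trajectories) of the vector field $b(t,\cdot)$ at fixed $t$, i.e. the images of the maximal solutions $\gamma$ of $\frac{d}{ds}\gamma(s)=b(t,\gamma(s))$, including stationary points. The magnetic lines at times $t_1$ and $t_2$ are topologically equivalent if there is a homeomorphism of $\mathbb{T}^2$ onto itself mapping each integral line of $b(t_1,\cdot)$ onto an integral line of $b(t_2,\cdot)$. *)

theory Defs
  imports "HOL-Analysis.Analysis"
begin

section \<open>The torus\<close>

text \<open>Points of \<open>(\<real> / 2\<pi>\<int>)\<^sup>2\<close> are the cosets of \<open>(2\<pi>\<int>)\<^sup>2\<close> in the plane, with the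
  quotient topology. Functions on the torus are represented by their \<open>2\<pi>\<close>-periodic lifts to
  the plane.\<close>

definition torus_proj :: "real ^ 2 \<Rightarrow> (real ^ 2) set" where
  "torus_proj x = {y. \<forall>i. \<exists>k::int. y $ i = x $ i + 2 * pi * of_int k}"

definition torus :: "(real ^ 2) set topology" where
  "torus = topology (\<lambda>U. U \<subseteq> range torus_proj \<and> open (torus_proj -` U))"

lemma openin_torus: "openin torus U \<longleftrightarrow> U \<subseteq> range torus_proj \<and> open (torus_proj -` U)"
proof -
  have "istopology (\<lambda>U. U \<subseteq> range torus_proj \<and> open (torus_proj -` U))"
    unfolding istopology_def by (auto simp: vimage_Union)
  then show ?thesis
    by (simp add: torus_def)
qed

lemma topspace_torus: "topspace torus = range torus_proj"
proof
  show "topspace torus \<subseteq> range torus_proj"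
    unfolding topspace_def by (auto simp: openin_torus)
  have "openin torus (range torus_proj)"
    unfolding openin_torus by (auto simp: vimage_def)
  then show "range torus_proj \<subseteq> topspace torus"
    by (rule openin_subset)
qed

lemma quotient_map_torus_proj: "quotient_map euclidean torus torus_proj"
  unfolding quotient_map_def topspace_torus openin_torus by (auto simp: vimage_def)

definition periodic :: "(real ^ 2 \<Rightarrow> 'b) \<Rightarrow> bool" where
  "periodic f \<longleftrightarrow> (\<forall>x i. f (x + axis i (2 * pi)) = f x)"

definition zero_average :: "(real ^ 2 \<Rightarrow> real ^ 2) \<Rightarrow> bool" where
  "zero_average v \<longleftrightarrow> integral (cbox 0 (\<chi> i. 2 * pi)) v = 0"


section \<open>Smoothness\<close>

text \<open>\<open>C_k_on k S f\<close> is meant for sets \<open>S\<close> on which derivatives within \<open>S\<close> are unique, such as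
  the whole space or a closed half-space. On \<open>[0,\<infinity>) \<times> \<real>\<^sup>2\<close> it expresses smoothness up to and
  including the initial time, with one-sided time derivatives there.\<close>

fun C_k_on :: "nat \<Rightarrow> 'a::real_normed_vector set \<Rightarrow> ('a \<Rightarrow> 'b::real_normed_vector) \<Rightarrow> bool" where
  "C_k_on 0 S f \<longleftrightarrow> continuous_on S f"
| "C_k_on (Suc k) S f \<longleftrightarrow>
    (\<exists>f'. (\<forall>x\<in>S. (f has_derivative f' x) (at x within S)) \<and> (\<forall>v. C_k_on k S (\<lambda>x. f' x v)))"

definition smooth_on :: "'a::real_normed_vector set \<Rightarrow> ('a \<Rightarrow> 'b::real_normed_vector) \<Rightarrow> bool" where
  "smooth_on S f \<longleftrightarrow> (\<forall>k. C_k_on k S f)"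

definition smooth_torus :: "(real ^ 2 \<Rightarrow> 'b::real_normed_vector) \<Rightarrow> bool" where
  "smooth_torus f \<longleftrightarrow> periodic f \<and> smooth_on UNIV f"

text \<open>A time-dependent function \<open>f\<close> is regarded as a function on \<open>[0,\<infinity>)\<close> times the torus;
  its values at negative times are irrelevant.\<close>

definition smooth_time_torus :: "(real \<Rightarrow> real ^ 2 \<Rightarrow> 'b::real_normed_vector) \<Rightarrow> bool" where
  "smooth_time_torus f \<longleftrightarrow>
    (\<forall>t\<ge>0. periodic (f t)) \<and> smooth_on ({0..} \<times> UNIV) (\<lambda>(t, x). f t x)"


section \<open>Differential operators\<close>

definition partial :: "2 \<Rightarrow> (real ^ 2 \<Rightarrow> 'b::real_normed_vector) \<Rightarrow> real ^ 2 \<Rightarrow> 'b" where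
  "partial i f x = vector_derivative (\<lambda>s. f (x + axis i s)) (at 0)"

definition time_deriv :: "(real \<Rightarrow> real ^ 2 \<Rightarrow> 'b::real_normed_vector) \<Rightarrow> real \<Rightarrow> real ^ 2 \<Rightarrow> 'b" where
  "time_deriv f t x = vector_derivative (\<lambda>s. f s x) (at t within {0..})"

definition grad :: "(real ^ 2 \<Rightarrow> real) \<Rightarrow> real ^ 2 \<Rightarrow> real ^ 2" where
  "grad p x = (\<chi> i. partial i p x)"

definition divergence :: "(real ^ 2 \<Rightarrow> real ^ 2) \<Rightarrow> real ^ 2 \<Rightarrow> real" where
  "divergence v x = (\<Sum>i\<in>UNIV. partial i (\<lambda>y. v y $ i) x)"

definition laplacian :: "(real ^ 2 \<Rightarrow> real ^ 2) \<Rightarrow> real ^ 2 \<Rightarrow> real ^ 2" where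
  "laplacian v x = (\<Sum>i\<in>UNIV. partial i (partial i v) x)"

text \<open>\<open>advect v w\<close> is \<open>(v \<cdot> \<nabla>) w\<close>.\<close>

definition advect :: "(real ^ 2 \<Rightarrow> real ^ 2) \<Rightarrow> (real ^ 2 \<Rightarrow> real ^ 2) \<Rightarrow> real ^ 2 \<Rightarrow> real ^ 2" where
  "advect v w x = (\<Sum>i\<in>UNIV. v x $ i *\<^sub>R partial i w x)"

definition divergence_free :: "(real ^ 2 \<Rightarrow> real ^ 2) \<Rightarrow> bool" where
  "divergence_free v \<longleftrightarrow> (\<forall>x. divergence v x = 0)"


section \<open>The MHD equations\<close>

definition mhd_solution ::
  "real \<Rightarrow> real \<Rightarrow> (real \<Rightarrow> real ^ 2 \<Rightarrow> real ^ 2) \<Rightarrow> (real \<Rightarrow> real ^ 2 \<Rightarrow> real ^ 2) \<Rightarrow>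
   (real ^ 2 \<Rightarrow> real ^ 2) \<Rightarrow> (real ^ 2 \<Rightarrow> real ^ 2) \<Rightarrow>
   (real \<Rightarrow> real ^ 2 \<Rightarrow> real ^ 2) \<Rightarrow> (real \<Rightarrow> real ^ 2 \<Rightarrow> real ^ 2) \<Rightarrow> bool" where
  "mhd_solution \<nu> \<eta> f1 f2 u0 b0 u b \<longleftrightarrow>
    smooth_time_torus u \<and> smooth_time_torus b \<and>
    (\<exists>P. smooth_time_torus P \<and>
      (\<forall>t\<ge>0. \<forall>x.
        time_deriv u t x + advect (u t) (u t) x + grad (P t) x
          = \<nu> *\<^sub>R laplacian (u t) x + advect (b t) (b t) x + f1 t x)) \<and>
    (\<forall>t\<ge>0. \<forall>x.
      time_deriv b t x + advect (u t) (b t) x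
        = advect (b t) (u t) x + \<eta> *\<^sub>R laplacian (b t) x + f2 t x) \<and>
    (\<forall>t\<ge>0. divergence_free (u t) \<and> divergence_free (b t)) \<and>
    u 0 = u0 \<and> b 0 = b0"

definition zero_average_mhd_solution ::
  "real \<Rightarrow> real \<Rightarrow> (real \<Rightarrow> real ^ 2 \<Rightarrow> real ^ 2) \<Rightarrow> (real \<Rightarrow> real ^ 2 \<Rightarrow> real ^ 2) \<Rightarrow>
   (real ^ 2 \<Rightarrow> real ^ 2) \<Rightarrow> (real ^ 2 \<Rightarrow> real ^ 2) \<Rightarrow>
   (real \<Rightarrow> real ^ 2 \<Rightarrow> real ^ 2) \<Rightarrow> (real \<Rightarrow> real ^ 2 \<Rightarrow> real ^ 2) \<Rightarrow> bool" where
  "zero_average_mhd_solution \<nu> \<eta> f1 f2 u0 b0 u b \<longleftrightarrow>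
    mhd_solution \<nu> \<eta> f1 f2 u0 b0 u b \<and> (\<forall>t\<ge>0. zero_average (u t) \<and> zero_average (b t))"


section \<open>Integral lines and topological equivalence\<close>

definition integral_curve :: "(real ^ 2 \<Rightarrow> real ^ 2) \<Rightarrow> real set \<Rightarrow> (real \<Rightarrow> real ^ 2) \<Rightarrow> bool" where
  "integral_curve v J \<gamma> \<longleftrightarrow>
    open J \<and> is_interval J \<and> J \<noteq> {} \<and> (\<forall>s\<in>J. (\<gamma> has_vector_derivative v (\<gamma> s)) (at s))"

definition maximal_integral_curve ::
  "(real ^ 2 \<Rightarrow> real ^ 2) \<Rightarrow> real set \<Rightarrow> (real \<Rightarrow> real ^ 2) \<Rightarrow> bool" where
  "maximal_integral_curve v J \<gamma> \<longleftrightarrow>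
    integral_curve v J \<gamma> \<and>
    (\<forall>J' \<gamma>'. integral_curve v J' \<gamma>' \<and> J \<subseteq> J' \<and> (\<forall>s\<in>J. \<gamma>' s = \<gamma> s) \<longrightarrow> J' = J)"

text \<open>Integral lines are subsets of the torus. Since \<open>torus_proj\<close> is a covering map, the
  integral curves on the torus are the projections of those of the periodic lift.\<close>

definition integral_lines :: "(real ^ 2 \<Rightarrow> real ^ 2) \<Rightarrow> (real ^ 2) set set set" where
  "integral_lines v = {torus_proj ` \<gamma> ` J | J \<gamma>. maximal_integral_curve v J \<gamma>}"

definition topologically_equivalent ::
  "(real ^ 2 \<Rightarrow> real ^ 2) \<Rightarrow> (real ^ 2 \<Rightarrow> real ^ 2) \<Rightarrow> bool" where
  "topologically_equivalent v w \<longleftrightarrow>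
    (\<exists>h. homeomorphic_map torus torus h \<and>
      (\<forall>L\<in>integral_lines v. h ` L \<in> integral_lines w))"

end

theory Submission
  imports Defs
begin

text \<open>The forces are at our disposal, so a solution may be prescribed and the forces computed from the
  equations. The fluid is kept at rest, \<open>u = 0\<close>, and the magnetic field is
  \<open>b(t,x) = (sin x\<^sub>2, (t/T) sin x\<^sub>1)\<close>. At \<open>t = 0\<close> this is a shear: its lines are horizontal
  circles, together with all the points of the two circles on which \<open>sin x\<^sub>2\<close> vanishes. At \<open>t = T\<close> it
  is a cellular field, with islands around its centres, separatrices, and only four stationary
  points. The field has stream function \<open>(t/T) cos x\<^sub>1 - cos x\<^sub>2\<close>, a sum of eigenfunctions of the
  Laplacian with the same eigenvalue, and hence its Lorentz force \<open>(b \<cdot> \<nabla>) b\<close> is a gradient; the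
  pressure balances it, and \<open>f1 = 0\<close> is enough for rest to persist. Only the induction equation is
  forced, by \<open>f2 = \<partial>\<^sub>t b - \<eta> \<Delta> b\<close>.

  The lines at the two times are told apart by the stationary points
  (\<open>topologically_equivalent_finite_stationary\<close>). A point of the torus is stationary exactly when
  it is a line by itself, so a homeomorphism that maps lines to lines maps stationary points
  injectively to stationary points, and infinitely many do not fit into four.

  Uniqueness (\<open>mhd_solution_unique\<close>) is the classical energy argument. The difference \<open>(w, h)\<close> of two
  smooth solutions with the same data solves a linear system. In the time derivative of
  \<open>\<integral> |w|\<^sup>2 + |h|\<^sup>2\<close> over a period cell, transport terms and pressure integrate to zero because the
  fields are divergence free, diffusion contributes a nonpositive amount, and what remains is
  bounded by the energy times the size of the derivatives of one of the solutions
  (\<open>linearized_mhd_energy_bound\<close>). Groenwall's inequality finishes the proof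
  (\<open>linearized_mhd_trivial\<close>). Integration by parts rests on a single fact: a partial derivative of a
  periodic function has integral zero over a period cell (\<open>integral_cell_derivative_zero\<close>).\<close>

section \<open>Calculus of smooth fields\<close>

lemma C_k_on_cong:
  assumes "\<And>x. x \<in> S \<Longrightarrow> f x = g x" and "C_k_on k S f"
  shows "C_k_on k S g"
proof (cases k)
  case 0
  then show ?thesis
    using assms continuous_on_cong[of S S f g] by simp
next
  case (Suc m)
  then obtain f' where f': "\<And>x. x \<in> S \<Longrightarrow> (f has_derivative f' x) (at x within S)"
      "\<And>v. C_k_on m S (\<lambda>x. f' x v)"
    using assms(2) by auto
  have "(g has_derivative f' x) (at x within S)" if "x \<in> S" for x
    using has_derivative_transform[OF that _ f'(1)[OF that]] assms(1) by auto
  then show ?thesis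
    using f'(2) Suc by auto
qed

lemma C_k_on_const: "C_k_on k S (\<lambda>x. c)"
  by (induction k arbitrary: c) (auto intro!: exI[of _ "\<lambda>x v. 0"])

lemma C_k_on_lincomb:
  assumes "C_k_on k S f" and "C_k_on k S g"
  shows "C_k_on k S (\<lambda>x. c *\<^sub>R f x + d *\<^sub>R g x)"
  using assms
proof (induction k arbitrary: f g)
  case 0
  then show ?case by (auto intro!: continuous_intros)
next
  case (Suc k)
  from Suc.prems obtain f' g' where
    "\<And>x. x \<in> S \<Longrightarrow> (f has_derivative f' x) (at x within S)" "\<And>v. C_k_on k S (\<lambda>x. f' x v)"
    "\<And>x. x \<in> S \<Longrightarrow> (g has_derivative g' x) (at x within S)" "\<And>v. C_k_on k S (\<lambda>x. g' x v)"
    unfolding C_k_on.simps by blast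
  then show ?case
    using Suc.IH by (auto intro!: exI[of _ "\<lambda>x v. c *\<^sub>R f' x v + d *\<^sub>R g' x v"] derivative_intros)
qed

text \<open>The derivative of such a function in any direction is again of this form, with other
  coefficients: smoothness of all orders follows by one induction, and products never have to be
  differentiated repeatedly.\<close>

lemma C_k_on_wave:
  fixes a b c d :: "'b::real_normed_vector" and m :: "'a::real_inner"
  shows "C_k_on k S (\<lambda>(t, x). sin (m \<bullet> x) *\<^sub>R (a + t *\<^sub>R b) + cos (m \<bullet> x) *\<^sub>R (c + t *\<^sub>R d))"
proof (induction k arbitrary: a b c d)
  case 0
  then show ?case
    by (auto simp: case_prod_unfold intro!: continuous_intros)
next
  case (Suc k)
  define F where "F a b c d = (\<lambda>(t, x). sin (m \<bullet> x) *\<^sub>R (a + t *\<^sub>R b) + cos (m \<bullet> x) *\<^sub>R (c + t *\<^sub>R d))"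
    for a b c d :: 'b
  have "(F a b c d has_derivative
      (\<lambda>(s, v). F (s *\<^sub>R b - (m \<bullet> v) *\<^sub>R c) (- ((m \<bullet> v) *\<^sub>R d))
        ((m \<bullet> v) *\<^sub>R a + s *\<^sub>R d) ((m \<bullet> v) *\<^sub>R b) p)) (at p within S)" for p
    unfolding F_def case_prod_unfold
    by (auto intro!: derivative_eq_intros simp: fun_eq_iff algebra_simps)
  moreover have "C_k_on k S (\<lambda>p. (\<lambda>(s, v). F (s *\<^sub>R b - (m \<bullet> v) *\<^sub>R c) (- ((m \<bullet> v) *\<^sub>R d))
        ((m \<bullet> v) *\<^sub>R a + s *\<^sub>R d) ((m \<bullet> v) *\<^sub>R b) p) w)" for w
    unfolding F_def by (cases w) (simp only: prod.case, rule Suc.IH)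
  ultimately have "C_k_on (Suc k) S (F a b c d)"
    unfolding C_k_on.simps by (intro exI conjI ballI allI)
  then show ?case
    by (simp add: F_def)
qed

lemma smooth_time_torusD:
  assumes "smooth_time_torus f"
  shows "t \<ge> 0 \<Longrightarrow> periodic (f t)" and "C_k_on k ({0..} \<times> UNIV) (\<lambda>(t, x). f t x)"
  using assms by (auto simp: smooth_time_torus_def smooth_on_def)

lemma smooth_time_torus_continuous:
  assumes "smooth_time_torus f"
  shows "continuous_on ({0..} \<times> UNIV) (\<lambda>(t, x). f t x)"
  using smooth_time_torusD(2)[OF assms, of 0] by simp

lemma smooth_time_torus_lincomb:
  assumes "smooth_time_torus f" and "smooth_time_torus g"
  shows "smooth_time_torus (\<lambda>t x. c *\<^sub>R f t x + d *\<^sub>R g t x)"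
  using assms C_k_on_lincomb[where c = c and d = d and S = "{0..} \<times> UNIV" and
      f = "\<lambda>(t, x). f t x" and g = "\<lambda>(t, x). g t x"]
  by (auto simp: smooth_time_torus_def smooth_on_def periodic_def case_prod_unfold)

lemma smooth_time_torus_diff:
  assumes "smooth_time_torus f" and "smooth_time_torus g"
  shows "smooth_time_torus (\<lambda>t x. f t x - g t x)"
  using smooth_time_torus_lincomb[OF assms, of 1 "-1"] by simp

lemma axis_eq_scaleR: "axis i s = s *\<^sub>R axis i (1::real)"
  by (simp add: vec_eq_iff axis_def)

lemma axis_zero: "axis i 0 = 0"
  by simp

text \<open>A derivative on the half-space \<open>[0,\<infinity>) \<times> \<real>\<^sup>2\<close> is one-sided in time at \<open>t = 0\<close>, but a space-time
  slice \<open>{t} \<times> \<real>\<^sup>2\<close> lies entirely inside it, so that space derivatives are two-sided at every time.\<close>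

lemma partial_within_derivative:
  fixes f :: "real \<Rightarrow> real ^ 2 \<Rightarrow> 'b::real_normed_vector"
  assumes "((\<lambda>(t, x). f t x) has_derivative f') (at (t, x) within {0..} \<times> UNIV)" and "t \<ge> 0"
  shows "((\<lambda>s. f t (x + axis i s)) has_vector_derivative f' (0, axis i 1)) (at 0)"
proof -
  have "((\<lambda>s. (t, x + s *\<^sub>R axis i 1)) has_derivative (\<lambda>s. (0, s *\<^sub>R axis i 1))) (at 0)"
    by (auto intro!: derivative_eq_intros)
  then have "((\<lambda>s. (t, x + axis i s)) has_derivative (\<lambda>s. (0, axis i s))) (at 0)"
    by (simp only: axis_eq_scaleR[symmetric])
  moreover have "((\<lambda>(t, x). f t x) has_derivative f')
      (at (t, x + axis i 0) within range (\<lambda>s. (t, x + axis i s)))"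
    by (rule has_derivative_subset) (use assms in \<open>auto simp: axis_zero\<close>)
  ultimately have "((\<lambda>s. f t (x + axis i s)) has_derivative (\<lambda>s. f' (0, axis i s))) (at 0)"
    using has_derivative_in_compose[where f = "\<lambda>s. (t, x + axis i s)" and s = UNIV and x = 0
        and g = "\<lambda>(t, x). f t x" and g' = f' and f' = "\<lambda>s. (0, axis i s)"]
    by (simp only: prod.case)
  moreover have "f' (0, axis i s) = s *\<^sub>R f' (0, axis i 1)" for s
  proof -
    have "(0, axis i s) = s *\<^sub>R (0 :: real, axis i (1::real))"
      by (simp add: axis_eq_scaleR[of i s])
    then show ?thesis
      using linear_scale[OF has_derivative_linear[OF assms(1)], of s "(0, axis i 1)"] by (rule ssubst)
  qed
  ultimately show ?thesis
    unfolding has_vector_derivative_def by (rule has_derivative_eq_rhs[OF _ ext])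
qed

lemma time_deriv_within_derivative:
  fixes f :: "real \<Rightarrow> real ^ 2 \<Rightarrow> 'b::real_normed_vector"
  assumes "((\<lambda>(t, x). f t x) has_derivative f') (at (t, x) within {0..} \<times> UNIV)"
  shows "((\<lambda>s. f s x) has_vector_derivative f' (1, 0)) (at t within {0..})"
proof -
  have "((\<lambda>s. (s, x)) has_derivative (\<lambda>s. (s, 0))) (at t within {0..})"
    by (auto intro!: derivative_eq_intros)
  moreover have "((\<lambda>(t, x). f t x) has_derivative f') (at (t, x) within (\<lambda>s. (s, x)) ` {0..})"
    by (rule has_derivative_subset[OF assms]) auto
  ultimately have "((\<lambda>s. f s x) has_derivative (\<lambda>s. f' (s, 0))) (at t within {0..})"
    using has_derivative_in_compose[where f = "\<lambda>s. (s, x)" and s = "{0..}" and x = t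
        and g = "\<lambda>(t, x). f t x" and g' = f' and f' = "\<lambda>s. (s, 0)"]
    by (simp only: prod.case)
  moreover have "f' (s, 0) = s *\<^sub>R f' (1, 0)" for s
  proof -
    have "(s, 0 :: real ^ 2) = s *\<^sub>R (1, 0)"
      by simp
    then show ?thesis
      using linear_scale[OF has_derivative_linear[OF assms], of s "(1, 0)"] by (rule ssubst)
  qed
  ultimately show ?thesis
    unfolding has_vector_derivative_def by (rule has_derivative_eq_rhs[OF _ ext])
qed

lemma has_time_deriv_unique:
  fixes f :: "real \<Rightarrow> real ^ 2 \<Rightarrow> 'b::real_normed_vector"
  assumes "((\<lambda>s. f s x) has_vector_derivative f') (at t within {0..})" and "t \<ge> 0"
  shows "time_deriv f t x = f'"
proof -
  have "at t within {0..} \<noteq> bot"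
  proof -
    have "at t within {t..t+1} \<noteq> bot"
      by (simp add: trivial_limit_within islimpt_Icc)
    then show ?thesis
      using at_le[of "{t..t+1}" "{0..}" t] assms(2) by (auto simp: bot_unique)
  qed
  then show ?thesis
    unfolding time_deriv_def by (rule vector_derivative_within) (rule assms(1))
qed

lemma smooth_has_partial:
  assumes "smooth_time_torus f" and "t \<ge> 0"
  shows "((\<lambda>s. f t (x + axis i s)) has_vector_derivative partial i (f t) x) (at 0)"
proof -
  obtain f' where "((\<lambda>(t, x). f t x) has_derivative f' (t, x)) (at (t, x) within {0..} \<times> UNIV)"
    using smooth_time_torusD(2)[OF assms(1), of "Suc 0"] assms(2) by auto
  from partial_within_derivative[OF this assms(2)] show ?thesis
    unfolding partial_def by (metis vector_derivative_at)
qed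

lemma smooth_has_time_deriv:
  assumes "smooth_time_torus f" and "t \<ge> 0"
  shows "((\<lambda>s. f s x) has_vector_derivative time_deriv f t x) (at t within {0..})"
proof -
  obtain f' where "((\<lambda>(t, x). f t x) has_derivative f' (t, x)) (at (t, x) within {0..} \<times> UNIV)"
    using smooth_time_torusD(2)[OF assms(1), of "Suc 0"] assms(2) by auto
  note D = time_deriv_within_derivative[OF this]
  show ?thesis
    using D has_time_deriv_unique[where f = f and x = x, OF D assms(2)] by simp
qed

text \<open>Since \<open>partial\<close> is given by a formula, it agrees with the appropriate direction of whichever total
  derivative the order of smoothness \<open>k\<close> supplies; the total derivatives for different \<open>k\<close> need not
  be compared with each other.\<close>

lemma smooth_time_torus_partial:
  assumes "smooth_time_torus f"
  shows "smooth_time_torus (\<lambda>t. partial i (f t))"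
  unfolding smooth_time_torus_def smooth_on_def
proof (intro conjI allI impI)
  fix t :: real assume "t \<ge> 0"
  then show "periodic (partial i (f t))"
    using smooth_time_torusD(1)[OF assms, of t]
    by (simp add: periodic_def partial_def add.assoc add.commute[of "axis _ (2 * pi)"])
      (simp add: add.assoc[symmetric])
next
  fix k
  obtain f' where f': "\<And>t x. t \<ge> 0 \<Longrightarrow>
        ((\<lambda>(t, x). f t x) has_derivative f' (t, x)) (at (t, x) within {0..} \<times> UNIV)"
      "\<And>v. C_k_on k ({0..} \<times> UNIV) (\<lambda>p. f' p v)"
    using smooth_time_torusD(2)[OF assms, of "Suc k"] by auto
  have "partial i (f t) x = f' (t, x) (0, axis i 1)" if "t \<ge> 0" for t x
    unfolding partial_def
    by (rule vector_derivative_at) (rule partial_within_derivative[OF f'(1)[OF that] that])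
  then show "C_k_on k ({0..} \<times> UNIV) (\<lambda>(t, x). partial i (f t) x)"
    by (intro C_k_on_cong[OF _ f'(2)[of "(0, axis i 1)"]]) auto
qed

lemma continuous_on_time_deriv:
  assumes "smooth_time_torus f"
  shows "continuous_on ({0..} \<times> UNIV) (\<lambda>(t, x). time_deriv f t x)"
proof -
  obtain f' where f': "\<And>t x. t \<ge> 0 \<Longrightarrow>
        ((\<lambda>(t, x). f t x) has_derivative f' (t, x)) (at (t, x) within {0..} \<times> UNIV)"
      "\<And>v. C_k_on 0 ({0..} \<times> UNIV) (\<lambda>p. f' p v)"
    using smooth_time_torusD(2)[OF assms, of "Suc 0"] by auto
  have "time_deriv f t x = f' (t, x) (1, 0)" if "t \<ge> 0" for t x
    using has_time_deriv_unique[where f = f and x = x,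
        OF time_deriv_within_derivative[OF f'(1)[OF that]] that] .
  then show ?thesis
    using C_k_on_cong[OF _ f'(2)[of "(1, 0)"], of "\<lambda>(t, x). time_deriv f t x"] by auto
qed

lemma partial_diff:
  assumes "smooth_time_torus f" and "smooth_time_torus g" and "t \<ge> 0"
  shows "partial i (\<lambda>x. f t x - g t x) = (\<lambda>x. partial i (f t) x - partial i (g t) x)"
  unfolding partial_def[of i "\<lambda>x. f t x - g t x"]
  using assms by (intro ext vector_derivative_at has_vector_derivative_diff smooth_has_partial)

lemma time_deriv_diff:
  assumes "smooth_time_torus f" and "smooth_time_torus g" and "t \<ge> 0"
  shows "time_deriv (\<lambda>t x. f t x - g t x) t x = time_deriv f t x - time_deriv g t x"
  using assms by (intro has_time_deriv_unique has_vector_derivative_diff smooth_has_time_deriv)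

section \<open>Integration over a period cell\<close>

abbreviation "cell \<equiv> cbox 0 (\<chi> i. 2 * pi) :: (real ^ 2) set"

lemma periodic_torus_proj:
  assumes "periodic f" and "y \<in> torus_proj x"
  shows "f y = f x"
proof -
  have shift_nat: "f (z + axis i (2 * pi * of_nat n)) = f z" for z i n
  proof (induction n)
    case 0
    then show ?case by (simp add: axis_zero)
  next
    case (Suc n)
    have "z + axis i (2 * pi * of_nat (Suc n)) = (z + axis i (2 * pi * of_nat n)) + axis i (2 * pi)"
      by (simp add: vec_eq_iff axis_def algebra_simps)
    then show ?case
      using Suc assms(1) unfolding periodic_def by (simp only:)
  qed
  have shift: "f (z + axis i (2 * pi * of_int k)) = f z" for z i k
  proof (cases "k \<ge> 0")
    case True
    then show ?thesis
      using shift_nat[of z i "nat k"] by simp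
  next
    case False
    have "z = (z + axis i (2 * pi * of_int k)) + axis i (2 * pi * of_nat (nat (- k)))"
      using False by (simp add: vec_eq_iff axis_def algebra_simps)
    then show ?thesis
      using shift_nat by metis
  qed
  obtain k where k: "\<And>i. y $ i = x $ i + 2 * pi * of_int (k i)"
    using assms(2) unfolding torus_proj_def by (auto simp: choice_iff)
  have "y = (x + axis 1 (2 * pi * of_int (k 1))) + axis 2 (2 * pi * of_int (k 2))"
    by (simp add: vec_eq_iff forall_2 k axis_def)
  then show ?thesis
    by (simp only: shift)
qed

lemma torus_proj_cell: "\<exists>y\<in>cell. x \<in> torus_proj y"
proof -
  let ?k = "\<lambda>i. \<lfloor>x $ i / (2 * pi)\<rfloor>"
  let ?y = "\<chi> i. x $ i - 2 * pi * of_int (?k i)"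
  have "0 \<le> ?y $ i \<and> ?y $ i \<le> 2 * pi" for i
  proof -
    have "of_int (?k i) \<le> x $ i / (2 * pi)" "x $ i / (2 * pi) \<le> of_int (?k i) + 1"
      by linarith+
    then have "of_int (?k i) * (2 * pi) \<le> x $ i" "x $ i \<le> (of_int (?k i) + 1) * (2 * pi)"
      by (simp_all only: pos_le_divide_eq pos_divide_le_eq pi_gt_zero zero_less_mult_iff
          zero_less_numeral simp_thms)
    then show ?thesis
      by (simp add: algebra_simps)
  qed
  then have "?y \<in> cell"
    by (simp add: mem_box_cart)
  moreover have "x \<in> torus_proj ?y"
    unfolding torus_proj_def by (auto intro!: exI[of _ "?k _"])
  ultimately show ?thesis by blast
qed

text \<open>The translated cell loses the slab between \<open>0\<close> and \<open>s\<close> and gains the one between \<open>2\<pi>\<close> and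
  \<open>2\<pi> + s\<close>, on which a periodic function takes the same values.\<close>

lemma integral_cell_translate:
  fixes f :: "real ^ 2 \<Rightarrow> 'b::banach"
  assumes per: "periodic f" and cont: "continuous_on UNIV f" and s: "0 \<le> s" "s \<le> 2 * pi"
  shows "integral cell (\<lambda>x. f (x + axis i s)) = integral cell f"
proof -
  let ?p = "(\<chi> i. 2 * pi) :: real ^ 2"
  let ?e = "axis i (2 * pi) :: real ^ 2"
  have int: "f integrable_on cbox a b" for a b
    by (rule integrable_continuous) (rule continuous_on_subset[OF cont], simp)
  have ax: "axis i (1::real) \<in> Basis" by simp
  have shift: "integral (cbox a b) (\<lambda>x. f (x + c)) = integral (cbox (a + c) (b + c)) f" for a b c
    using integral_shift_cbox_plus[of a b f c] by (simp add: comp_def add.commute)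
  have comp: "x \<bullet> axis i 1 = x $ i" for x :: "real ^ 2"
    by (simp add: inner_axis)
  have axis_nth_if: "axis i r $ j = (if j = i then r else 0)" for r :: real and i j :: 2
    by (simp add: axis_def)
  have lower: "cell \<inter> {x. x \<bullet> axis i 1 \<le> s} = cbox 0 (\<chi> j. if j = i then s else 2 * pi)"
    using s exhaust_2[of i] by (auto simp: mem_box_cart comp forall_2)
  have upper: "cell \<inter> {x. x \<bullet> axis i 1 \<ge> s} = cbox (axis i s) ?p"
    using s exhaust_2[of i] by (auto simp: mem_box_cart comp axis_nth_if forall_2)
  have lower': "cbox (axis i s) (?p + axis i s) \<inter> {x. x \<bullet> axis i 1 \<le> 2 * pi} = cbox (axis i s) ?p"
    using s exhaust_2[of i] by (auto simp: mem_box_cart comp axis_nth_if forall_2)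
  have upper': "cbox (axis i s) (?p + axis i s) \<inter> {x. x \<bullet> axis i 1 \<ge> 2 * pi}
      = cbox (0 + ?e) ((\<chi> j. if j = i then s else 2 * pi) + ?e)"
    using s exhaust_2[of i] by (auto simp: mem_box_cart comp axis_nth_if forall_2)
  have "integral cell (\<lambda>x. f (x + axis i s)) = integral (cbox (axis i s) (?p + axis i s)) f"
    using shift[of 0 ?p "axis i s"] by simp
  also have "\<dots> = integral (cbox (axis i s) ?p) f
      + integral (cbox (0 + ?e) ((\<chi> j. if j = i then s else 2 * pi) + ?e)) f"
    using integral_split[OF int ax, of "axis i s" "?p + axis i s" "2 * pi"]
    by (simp only: lower' upper')
  also have "integral (cbox (0 + ?e) ((\<chi> j. if j = i then s else 2 * pi) + ?e)) f
      = integral (cbox 0 (\<chi> j. if j = i then s else 2 * pi)) f"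
    using per shift[of 0 "\<chi> j. if j = i then s else 2 * pi" ?e] by (simp add: periodic_def)
  also have "integral (cbox (axis i s) ?p) f + \<dots> = integral cell f"
    using integral_split[OF int ax, of 0 ?p s] by (simp only: lower upper add.commute)
  finally show ?thesis .
qed

text \<open>The integral of the translates of \<open>f\<close> does not depend on the translation; differentiation under
  the integral sign at translation \<open>0\<close> gives the integral of \<open>f'\<close>. No iterated integrals are
  involved.\<close>

lemma integral_cell_derivative_zero:
  fixes f f' :: "real ^ 2 \<Rightarrow> 'b::banach"
  assumes per: "periodic f" and cont: "continuous_on UNIV f" and cont': "continuous_on UNIV f'"
    and deriv: "\<And>x. ((\<lambda>s. f (x + axis i s)) has_vector_derivative f' x) (at 0)"
  shows "integral cell f' = 0"
proof -
  let ?I = "{0..2 * pi}"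
  have "continuous_on UNIV (\<lambda>p. snd p + fst p *\<^sub>R axis i (1::real))"
    by (intro continuous_intros)
  then have cont_axis: "continuous_on UNIV (\<lambda>p. snd p + axis i (fst p :: real))"
    by (simp only: axis_eq_scaleR[symmetric])
  have deriv_s: "((\<lambda>s. f (x + axis i s)) has_vector_derivative f' (x + axis i s)) (at s within ?I)"
    for x s
  proof -
    have "((\<lambda>r. f ((x + axis i s) + axis i r)) \<circ> (\<lambda>r. r - s) has_vector_derivative
        1 *\<^sub>R f' (x + axis i s)) (at s)"
      by (rule vector_diff_chain_at) (auto intro!: derivative_eq_intros deriv)
    moreover have "(x + axis i s) + axis i (r - s) = x + axis i r" for r
      by (simp add: vec_eq_iff axis_def)
    ultimately show ?thesis
      by (simp add: comp_def has_vector_derivative_at_within)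
  qed
  have "((\<lambda>s. integral cell (\<lambda>x. f (x + axis i s))) has_vector_derivative
      integral cell (\<lambda>x. f' (x + axis i 0))) (at 0 within ?I)"
  proof (rule leibniz_rule_vector_derivative[OF deriv_s])
    show "(\<lambda>x. f (x + axis i s)) integrable_on cell" for s
      by (intro integrable_continuous continuous_on_compose2[OF cont] continuous_intros) auto
    show "continuous_on (?I \<times> cell) (\<lambda>(s, x). f' (x + axis i s))"
      unfolding case_prod_unfold
      by (rule continuous_on_compose2[OF cont' continuous_on_subset[OF cont_axis]]) auto
  qed auto
  then have "((\<lambda>s. integral cell (\<lambda>x. f (x + axis i s))) has_vector_derivative integral cell f')
      (at 0 within ?I)"
    by (simp add: axis_zero)
  then have "((\<lambda>s. integral cell f) has_vector_derivative integral cell f') (at 0 within ?I)"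
    by (rule has_vector_derivative_transform[rotated 2])
      (use integral_cell_translate[OF per cont] in auto)
  moreover have "((\<lambda>s. integral cell f) has_vector_derivative 0) (at 0 within ?I)"
    by simp
  ultimately show ?thesis
    by (rule vector_derivative_unique_within[rotated]) (simp add: trivial_limit_within islimpt_Icc)
qed

text \<open>The identities below concern a single instant. This is the regularity they use: it is inherited
  from smooth time-dependent fields and is stable under products.\<close>

definition periodic_C1 :: "(real ^ 2 \<Rightarrow> 'b::real_normed_vector) \<Rightarrow> bool" where
  "periodic_C1 f \<longleftrightarrow> periodic f \<and> continuous_on UNIV f \<and>
    (\<forall>i. continuous_on UNIV (partial i f) \<and>
      (\<forall>x. ((\<lambda>s. f (x + axis i s)) has_vector_derivative partial i f x) (at 0)))"

lemma periodic_C1D: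
  assumes "periodic_C1 f"
  shows "periodic f" and "continuous_on S f" and "continuous_on S (partial i f)"
    and "((\<lambda>s. f (x + axis i s)) has_vector_derivative partial i f x) (at 0)"
  using assms continuous_on_subset[OF _ subset_UNIV] by (auto simp: periodic_C1_def)

lemma continuous_on_slice:
  assumes "continuous_on ({0..} \<times> UNIV) (\<lambda>(t, x). f t x)" and "t \<ge> (0::real)"
  shows "continuous_on S (f t)"
proof -
  have "continuous_on S (\<lambda>x. (t, x))"
    by (intro continuous_intros)
  from continuous_on_compose2[OF assms(1) this] show ?thesis
    using assms(2) by auto
qed

lemma smooth_time_torus_periodic_C1:
  assumes "smooth_time_torus f" and "t \<ge> 0"
  shows "periodic_C1 (f t)"
  unfolding periodic_C1_def
  using assms smooth_time_torusD(1) smooth_has_partial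
    continuous_on_slice[OF smooth_time_torus_continuous]
    continuous_on_slice[OF smooth_time_torus_continuous[OF smooth_time_torus_partial]]
  by blast

lemma partial_component:
  assumes "periodic_C1 v"
  shows "partial i (\<lambda>y. v y $ j) x = partial i v x $ j"
  unfolding partial_def[of i "\<lambda>y. v y $ j"]
  by (rule vector_derivative_at)
    (rule bounded_linear.has_vector_derivative[OF bounded_linear_vec_nth periodic_C1D(4)[OF assms]])

lemma divergence_eq:
  assumes "periodic_C1 v"
  shows "divergence v x = (\<Sum>i\<in>UNIV. partial i v x $ i)"
  by (simp add: divergence_def partial_component[OF assms])

lemma partial_inner:
  fixes f g :: "real ^ 2 \<Rightarrow> 'b::real_inner"
  assumes "periodic_C1 f" and "periodic_C1 g"
  shows "((\<lambda>s. f (x + axis i s) \<bullet> g (x + axis i s)) has_vector_derivative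
      f x \<bullet> partial i g x + partial i f x \<bullet> g x) (at 0)"
  using bounded_bilinear.has_vector_derivative[OF bounded_bilinear_inner
      periodic_C1D(4)[OF assms(1)] periodic_C1D(4)[OF assms(2)]]
  by (simp add: axis_zero)

lemma periodic_C1_inner:
  fixes f g :: "real ^ 2 \<Rightarrow> 'b::real_inner"
  assumes "periodic_C1 f" and "periodic_C1 g"
  shows "periodic_C1 (\<lambda>x. f x \<bullet> g x)"
    and "partial i (\<lambda>x. f x \<bullet> g x) x = f x \<bullet> partial i g x + partial i f x \<bullet> g x"
proof -
  have eq: "partial i (\<lambda>x. f x \<bullet> g x) = (\<lambda>x. f x \<bullet> partial i g x + partial i f x \<bullet> g x)" for i
    unfolding partial_def[of i "\<lambda>x. f x \<bullet> g x"]
    by (intro ext vector_derivative_at partial_inner assms)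
  then show "partial i (\<lambda>x. f x \<bullet> g x) x = f x \<bullet> partial i g x + partial i f x \<bullet> g x"
    by simp
  show "periodic_C1 (\<lambda>x. f x \<bullet> g x)"
    unfolding periodic_C1_def eq
    using assms[THEN periodic_C1D(1)] partial_inner[OF assms]
    by (auto simp: periodic_def intro!: continuous_intros assms[THEN periodic_C1D(2)]
        assms[THEN periodic_C1D(3)])
qed

lemma has_integral_cell:
  fixes f :: "real ^ 2 \<Rightarrow> 'b::banach"
  assumes "continuous_on cell f"
  shows "(f has_integral integral cell f) cell"
  using assms integrable_continuous integrable_integral by blast

lemma integral_cell_partial_inner:
  fixes f g :: "real ^ 2 \<Rightarrow> 'b::real_inner"
  assumes "periodic_C1 f" and "periodic_C1 g"
  shows "((\<lambda>x. f x \<bullet> partial i g x + partial i f x \<bullet> g x) has_integral 0) cell"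
proof -
  have cont: "continuous_on S (\<lambda>x. f x \<bullet> partial i g x + partial i f x \<bullet> g x)" for S
    by (intro continuous_intros assms[THEN periodic_C1D(2)] assms[THEN periodic_C1D(3)])
  have "integral cell (\<lambda>x. f x \<bullet> partial i g x + partial i f x \<bullet> g x) = 0"
    using periodic_C1D(1,2)[OF periodic_C1_inner(1)[OF assms]] cont partial_inner[OF assms]
    by (rule integral_cell_derivative_zero)
  then show ?thesis
    using has_integral_cell[OF cont] by (simp only:)
qed

text \<open>For a divergence free \<open>v\<close> the integrand is the divergence of \<open>\<phi> v\<close>. The lemma makes the pressure
  term vanish (\<open>v\<close> the velocity, \<open>\<phi>\<close> the pressure) and, with \<open>\<phi> = w \<bullet> z\<close>, it makes transport a
  skew-symmetric operator.\<close>

lemma transport_integral: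
  fixes \<phi> :: "real ^ 2 \<Rightarrow> real"
  assumes v: "periodic_C1 v" "divergence_free v" and \<phi>: "periodic_C1 \<phi>"
  shows "((\<lambda>x. v x \<bullet> grad \<phi> x) has_integral 0) cell"
proof -
  have nth: "periodic_C1 (\<lambda>x. v x $ i)" for i
    using v(1) bounded_linear.has_vector_derivative[OF bounded_linear_vec_nth periodic_C1D(4)[OF v(1)]]
    by (auto simp: periodic_C1_def periodic_def partial_component[OF v(1), abs_def]
        intro!: continuous_intros)
  have "((\<lambda>x. \<Sum>i\<in>UNIV. v x $ i \<bullet> partial i \<phi> x + partial i (\<lambda>x. v x $ i) x \<bullet> \<phi> x)
      has_integral (\<Sum>i\<in>(UNIV :: 2 set). 0)) cell"
    by (intro has_integral_sum integral_cell_partial_inner nth \<phi>) auto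
  moreover have "(\<Sum>i\<in>UNIV. v x $ i \<bullet> partial i \<phi> x + partial i (\<lambda>x. v x $ i) x \<bullet> \<phi> x)
      = v x \<bullet> grad \<phi> x" for x
  proof -
    have "(\<Sum>i\<in>UNIV. partial i (\<lambda>x. v x $ i) x \<bullet> \<phi> x) = divergence v x * \<phi> x"
      by (simp add: divergence_def sum_distrib_right)
    then show ?thesis
      using v(2) by (simp add: sum.distrib grad_def inner_vec_def divergence_free_def)
  qed
  ultimately show ?thesis
    by simp
qed

lemma advect_skew_integral:
  assumes v: "periodic_C1 v" "divergence_free v" and "periodic_C1 w" and "periodic_C1 z"
  shows "((\<lambda>x. w x \<bullet> advect v z x + z x \<bullet> advect v w x) has_integral 0) cell"
proof -
  have "v x \<bullet> grad (\<lambda>x. w x \<bullet> z x) x = w x \<bullet> advect v z x + z x \<bullet> advect v w x" for x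
    by (simp add: inner_vec_def[of "v x"] grad_def periodic_C1_inner(2)[OF assms(3,4)] advect_def
        inner_sum_right distrib_left sum.distrib inner_commute[of _ "z x"])
  then show ?thesis
    using transport_integral[OF v periodic_C1_inner(1)[OF assms(3,4)]] by simp
qed

text \<open>Integration by parts turns the integral into \<open>- \<integral> |\<nabla>w|\<^sup>2\<close>.\<close>

lemma laplacian_integral_nonpos:
  assumes "periodic_C1 w" and "\<And>i. periodic_C1 (partial i w)"
  shows "integral cell (\<lambda>x. w x \<bullet> laplacian w x) \<le> 0"
proof -
  let ?d = "\<lambda>x. \<Sum>i\<in>UNIV. partial i w x \<bullet> partial i w x"
  have "((\<lambda>x. \<Sum>i\<in>UNIV. w x \<bullet> partial i (partial i w) x + partial i w x \<bullet> partial i w x)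
      has_integral (\<Sum>i\<in>(UNIV :: 2 set). 0)) cell"
    by (intro has_integral_sum integral_cell_partial_inner assms) auto
  moreover have "(?d has_integral integral cell ?d) cell"
    by (intro has_integral_cell continuous_intros periodic_C1D(3) assms)
  ultimately have "((\<lambda>x. (\<Sum>i\<in>UNIV. w x \<bullet> partial i (partial i w) x + partial i w x \<bullet> partial i w x)
      - ?d x) has_integral (\<Sum>i\<in>(UNIV :: 2 set). 0) - integral cell ?d) cell"
    by (rule has_integral_diff)
  then have "((\<lambda>x. w x \<bullet> laplacian w x) has_integral - integral cell ?d) cell"
    by (simp add: sum.distrib laplacian_def inner_sum_right)
  moreover have "integral cell ?d \<ge> 0"
    by (rule integral_nonneg) (auto intro!: sum_nonneg integrable_continuous continuous_intros
        periodic_C1D(3) assms)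
  ultimately show ?thesis
    by (simp add: integral_unique)
qed

section \<open>The energy estimate and uniqueness\<close>

lemma norm_advect_le: "norm (advect v w x) \<le> norm (v x) * (\<Sum>i\<in>UNIV. norm (partial i w x))"
  unfolding advect_def sum_distrib_left
  by (intro order_trans[OF norm_sum] sum_mono)
    (auto intro!: mult_right_mono component_le_norm_cart)

text \<open>\<open>exp (- K s) E s\<close> is nonincreasing. The mean value theorem for derivatives within \<open>{0..\<tau>}\<close> is used,
  because at time \<open>0\<close> only the one-sided derivative of the energy exists.\<close>

lemma gronwall_zero:
  fixes E E' :: "real \<Rightarrow> real"
  assumes deriv: "\<And>s. s \<in> {0..\<tau>} \<Longrightarrow> (E has_real_derivative E' s) (at s within {0..\<tau>})"
    and le: "\<And>s. s \<in> {0..\<tau>} \<Longrightarrow> E' s \<le> K * E s" and "E 0 = 0" and "0 < \<tau>"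
  shows "E \<tau> \<le> 0"
proof -
  have "((\<lambda>s. exp (- K * s) * E s) has_derivative
      (\<lambda>h. h * (exp (- K * s) * (E' s - K * E s)))) (at s within {0..\<tau>})" if "s \<in> {0..\<tau>}" for s
    using deriv[OF that] unfolding has_field_derivative_def
    by (auto intro!: derivative_eq_intros simp: algebra_simps)
  from mvt_simple[OF \<open>0 < \<tau>\<close> this] obtain s where s: "s \<in> {0<..<\<tau>}"
    "exp (- K * \<tau>) * E \<tau> - exp (- K * 0) * E 0 = (\<tau> - 0) * (exp (- K * s) * (E' s - K * E s))"
    by auto
  have "(\<tau> - 0) * (exp (- K * s) * (E' s - K * E s)) \<le> 0"
    using le[of s] s(1) by (intro mult_nonneg_nonpos) auto
  then have "exp (- K * \<tau>) * E \<tau> \<le> 0"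
    using s(2) \<open>E 0 = 0\<close> by simp
  then show ?thesis
    by (simp add: mult_le_0_iff not_le[symmetric])
qed

lemma continuous_on_advect:
  assumes "periodic_C1 v" and "periodic_C1 w"
  shows "continuous_on S (advect v w)"
  unfolding advect_def[abs_def]
  by (intro continuous_intros periodic_C1D(2)[OF assms(1)] periodic_C1D(3)[OF assms(2)])

text \<open>The left-hand side is the time derivative of the energy when \<open>w'\<close> and \<open>h'\<close> are the time derivatives
  of \<open>w\<close> and \<open>h\<close>. The two equations are those of the difference of two solutions: \<open>u\<close>, \<open>b\<close> belong to
  one of them and \<open>v\<close>, \<open>c\<close> to the other. Transport by \<open>v\<close> drops out of each equation separately,
  while transport by \<open>c\<close> moves energy between \<open>w\<close> and \<open>h\<close> and cancels only in the sum. What is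
  left differentiates \<open>u\<close> and \<open>b\<close> but not \<open>w\<close> and \<open>h\<close>.\<close>

lemma linearized_mhd_energy_bound:
  fixes w h u b v c w' h' :: "real ^ 2 \<Rightarrow> real ^ 2" and q :: "real ^ 2 \<Rightarrow> real"
  assumes C1: "periodic_C1 w" "periodic_C1 h" "periodic_C1 u" "periodic_C1 b"
      "periodic_C1 v" "periodic_C1 c" "periodic_C1 q"
      "\<And>i. periodic_C1 (partial i w)" "\<And>i. periodic_C1 (partial i h)"
    and cont: "continuous_on cell w'" "continuous_on cell h'"
    and div: "divergence_free w" "divergence_free v" "divergence_free c"
    and eq_w: "\<And>x. w' x + advect v w x + advect w u x + grad q x
      = \<nu> *\<^sub>R laplacian w x + advect c h x + advect h b x"
    and eq_h: "\<And>x. h' x + advect v h x + advect w b x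
      = \<eta> *\<^sub>R laplacian h x + advect c w x + advect h u x"
    and pos: "\<nu> \<ge> 0" "\<eta> \<ge> 0"
    and bound: "\<And>x. x \<in> cell \<Longrightarrow> (\<Sum>i\<in>UNIV. norm (partial i u x)) \<le> M"
      "\<And>x. x \<in> cell \<Longrightarrow> (\<Sum>i\<in>UNIV. norm (partial i b x)) \<le> M"
  shows "integral cell (\<lambda>x. 2 * (w x \<bullet> w' x + h x \<bullet> h' x))
    \<le> 4 * M * integral cell (\<lambda>x. w x \<bullet> w x + h x \<bullet> h x)"
proof -
  \<comment> \<open>the terms that do not cancel by integration by parts\<close>
  define R where "R x = w x \<bullet> advect h b x - w x \<bullet> advect w u x + h x \<bullet> advect h u x
    - h x \<bullet> advect w b x" for x
  have lap_cont: "continuous_on cell (\<lambda>x. z x \<bullet> laplacian z x)"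
    if "periodic_C1 z" "\<And>i. periodic_C1 (partial i z)" for z
    unfolding laplacian_def by (intro continuous_intros periodic_C1D(2,3) that)
  have R_cont: "continuous_on cell R"
    unfolding R_def by (intro continuous_intros continuous_on_advect periodic_C1D(2) C1)
  have e_cont: "continuous_on cell (\<lambda>x. w x \<bullet> w x + h x \<bullet> h x)"
    by (intro continuous_intros periodic_C1D(2) C1)
  \<comment> \<open>The transport terms are doubled so that each is an instance of skew-symmetry.\<close>
  have "((\<lambda>x. 2 * \<nu> * (w x \<bullet> laplacian w x) + 2 * \<eta> * (h x \<bullet> laplacian h x)
      + 2 * (w x \<bullet> advect c h x + h x \<bullet> advect c w x)
      - (w x \<bullet> advect v w x + w x \<bullet> advect v w x) - (h x \<bullet> advect v h x + h x \<bullet> advect v h x)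
      - 2 * (w x \<bullet> grad q x) + 2 * R x) has_integral
      2 * \<nu> * integral cell (\<lambda>x. w x \<bullet> laplacian w x)
      + 2 * \<eta> * integral cell (\<lambda>x. h x \<bullet> laplacian h x)
      + 2 * 0 - 0 - 0 - 2 * 0 + 2 * integral cell R) cell"
    by (intro has_integral_add has_integral_diff has_integral_mult_right advect_skew_integral
        transport_integral has_integral_cell lap_cont R_cont C1 div)
  moreover have "2 * \<nu> * (w x \<bullet> laplacian w x) + 2 * \<eta> * (h x \<bullet> laplacian h x)
      + 2 * (w x \<bullet> advect c h x + h x \<bullet> advect c w x)
      - (w x \<bullet> advect v w x + w x \<bullet> advect v w x) - (h x \<bullet> advect v h x + h x \<bullet> advect v h x)
      - 2 * (w x \<bullet> grad q x) + 2 * R x = 2 * (w x \<bullet> w' x + h x \<bullet> h' x)" for x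
  proof -
    have w': "w' x = \<nu> *\<^sub>R laplacian w x + advect c h x + advect h b x
        - advect v w x - advect w u x - grad q x"
      using eq_w[of x] by (simp add: algebra_simps)
    have h': "h' x = \<eta> *\<^sub>R laplacian h x + advect c w x + advect h u x
        - advect v h x - advect w b x"
      using eq_h[of x] by (simp add: algebra_simps)
    show ?thesis
      unfolding w' h' R_def by (simp add: inner_add_right inner_diff_right algebra_simps)
  qed
  ultimately have "integral cell (\<lambda>x. 2 * (w x \<bullet> w' x + h x \<bullet> h' x))
      = 2 * \<nu> * integral cell (\<lambda>x. w x \<bullet> laplacian w x)
      + 2 * \<eta> * integral cell (\<lambda>x. h x \<bullet> laplacian h x) + 2 * integral cell R"
    by (simp add: integral_unique)
  also have "\<dots> \<le> 2 * integral cell R"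
    using laplacian_integral_nonpos[OF C1(1) C1(8)] laplacian_integral_nonpos[OF C1(2) C1(9)] pos
    by (simp add: mult_nonneg_nonpos add_nonpos_nonpos)
  also have "integral cell R \<le> integral cell (\<lambda>x. 2 * M * (w x \<bullet> w x + h x \<bullet> h x))"
  proof (rule integral_le)
    show "R integrable_on cell"
      by (rule integrable_continuous[OF R_cont])
    show "(\<lambda>x. 2 * M * (w x \<bullet> w x + h x \<bullet> h x)) integrable_on cell"
      by (intro integrable_continuous continuous_on_mult continuous_on_const e_cont)
    fix x assume x: "x \<in> cell"
    have term_le: "\<bar>y \<bullet> advect z a x\<bar> \<le> M * (norm y * norm (z x))"
      if "(\<Sum>i\<in>UNIV. norm (partial i a x)) \<le> M" for y z a
    proof -
      have "\<bar>y \<bullet> advect z a x\<bar> \<le> norm y * norm (advect z a x)"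
        by (rule Cauchy_Schwarz_ineq2)
      also have "\<dots> \<le> norm y * (norm (z x) * M)"
        using that by (intro mult_left_mono order_trans[OF norm_advect_le]) auto
      finally show ?thesis by (simp add: algebra_simps)
    qed
    have M: "M \<ge> 0"
      using bound(1)[OF x] sum_nonneg[of UNIV "\<lambda>i. norm (partial i u x)"] by simp
    have "R x \<le> M * (norm (w x) * norm (h x)) + M * (norm (w x) * norm (w x))
        + M * (norm (h x) * norm (h x)) + M * (norm (h x) * norm (w x))"
      using term_le[OF bound(2)[OF x], of "w x" h] term_le[OF bound(1)[OF x], of "w x" w]
        term_le[OF bound(1)[OF x], of "h x" h] term_le[OF bound(2)[OF x], of "h x" w]
      unfolding R_def by linarith
    also have "\<dots> = M * (norm (w x) + norm (h x))\<^sup>2"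
      by (simp add: power2_eq_square algebra_simps)
    also have "\<dots> \<le> M * (2 * ((norm (w x))\<^sup>2 + (norm (h x))\<^sup>2))"
      using M sum_squares_bound[of "norm (w x)" "norm (h x)"]
      by (intro mult_left_mono) (simp_all add: power2_sum)
    finally show "R x \<le> 2 * M * (w x \<bullet> w x + h x \<bullet> h x)"
      by (simp add: power2_norm_eq_inner algebra_simps)
  qed
  finally show ?thesis
    by simp
qed

text \<open>On each interval \<open>[0,t]\<close> the derivatives of \<open>u\<close> and \<open>b\<close> are bounded by compactness, so the energy
  inequality holds there with a constant factor. The energy starts at zero and therefore stays
  zero; by continuity and periodicity so do \<open>w\<close> and \<open>h\<close>.\<close>

lemma linearized_mhd_trivial:
  fixes w h u b v c :: "real \<Rightarrow> real ^ 2 \<Rightarrow> real ^ 2" and q :: "real \<Rightarrow> real ^ 2 \<Rightarrow> real"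
  assumes smooth: "smooth_time_torus w" "smooth_time_torus h" "smooth_time_torus u"
      "smooth_time_torus b" "smooth_time_torus v" "smooth_time_torus c" "smooth_time_torus q"
    and div: "\<And>t. t \<ge> 0 \<Longrightarrow> divergence_free (w t)" "\<And>t. t \<ge> 0 \<Longrightarrow> divergence_free (v t)"
      "\<And>t. t \<ge> 0 \<Longrightarrow> divergence_free (c t)"
    and eq_w: "\<And>t x. t \<ge> 0 \<Longrightarrow>
      time_deriv w t x + advect (v t) (w t) x + advect (w t) (u t) x + grad (q t) x
        = \<nu> *\<^sub>R laplacian (w t) x + advect (c t) (h t) x + advect (h t) (b t) x"
    and eq_h: "\<And>t x. t \<ge> 0 \<Longrightarrow>
      time_deriv h t x + advect (v t) (h t) x + advect (w t) (b t) x
        = \<eta> *\<^sub>R laplacian (h t) x + advect (c t) (w t) x + advect (h t) (u t) x"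
    and pos: "\<nu> \<ge> 0" "\<eta> \<ge> 0"
    and init: "\<And>x. w 0 x = 0" "\<And>x. h 0 x = 0"
    and "t \<ge> 0"
  shows "w t x = 0 \<and> h t x = 0"
proof (cases "t = 0")
  case True
  then show ?thesis using init by simp
next
  case False
  then have t: "0 < t" using \<open>t \<ge> 0\<close> by simp
  define e where "e s x = w s x \<bullet> w s x + h s x \<bullet> h s x" for s x
  define e' where "e' s x = 2 * (w s x \<bullet> time_deriv w s x + h s x \<bullet> time_deriv h s x)" for s x
  have sub: "{0..t} \<times> cell \<subseteq> {0..} \<times> UNIV"
    by auto
  have cont: "continuous_on ({0..t} \<times> cell) (\<lambda>(s, x). f s x)" if "smooth_time_torus f"
    for f :: "real \<Rightarrow> real ^ 2 \<Rightarrow> real ^ 2"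
    using continuous_on_subset[OF smooth_time_torus_continuous[OF that] sub] .
  have cont': "continuous_on ({0..t} \<times> cell) (\<lambda>(s, x). time_deriv f s x)" if "smooth_time_torus f"
    for f :: "real \<Rightarrow> real ^ 2 \<Rightarrow> real ^ 2"
    using continuous_on_subset[OF continuous_on_time_deriv[OF that] sub] .
  have "\<exists>M. \<forall>p\<in>{0..t} \<times> cell. (\<lambda>(s, x). \<Sum>i\<in>UNIV. norm (partial i (f s) x)) p \<le> M"
    if f: "smooth_time_torus f" for f :: "real \<Rightarrow> real ^ 2 \<Rightarrow> real ^ 2"
  proof -
    have "continuous_on ({0..t} \<times> cell) (\<lambda>(s, x). \<Sum>i\<in>UNIV. norm (partial i (f s) x))"
      unfolding case_prod_unfold
      by (intro continuous_intros cont[OF smooth_time_torus_partial[OF f], unfolded case_prod_unfold])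
    then have "bounded ((\<lambda>(s, x). \<Sum>i\<in>UNIV. norm (partial i (f s) x)) ` ({0..t} \<times> cell))"
      by (intro compact_imp_bounded compact_continuous_image compact_Times) auto
    then show ?thesis
      unfolding bounded_iff by (metis (no_types, lifting) image_eqI abs_le_D1 real_norm_def)
  qed
  from this[OF smooth(3)] this[OF smooth(4)] obtain M1 M2 where
    "\<And>s x. s \<in> {0..t} \<Longrightarrow> x \<in> cell \<Longrightarrow> (\<Sum>i\<in>UNIV. norm (partial i (u s) x)) \<le> M1"
    "\<And>s x. s \<in> {0..t} \<Longrightarrow> x \<in> cell \<Longrightarrow> (\<Sum>i\<in>UNIV. norm (partial i (b s) x)) \<le> M2"
    by fastforce
  then have bound:
    "\<And>s x. s \<in> {0..t} \<Longrightarrow> x \<in> cell \<Longrightarrow> (\<Sum>i\<in>UNIV. norm (partial i (u s) x)) \<le> max M1 M2"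
    "\<And>s x. s \<in> {0..t} \<Longrightarrow> x \<in> cell \<Longrightarrow> (\<Sum>i\<in>UNIV. norm (partial i (b s) x)) \<le> max M1 M2"
    by (meson max.coboundedI1 max.coboundedI2)+
  have e_cont: "continuous_on S (e s)" if "s \<ge> 0" for s S
    unfolding e_def[abs_def]
    by (intro continuous_intros periodic_C1D(2) smooth_time_torus_periodic_C1 smooth that)
  have "integral cell (e t) \<le> 0"
  proof (rule gronwall_zero[where E = "\<lambda>s. integral cell (e s)" and E' = "\<lambda>s. integral cell (e' s)"])
    fix s assume s: "s \<in> {0..t}"
    show "((\<lambda>s. integral cell (e s)) has_real_derivative integral cell (e' s)) (at s within {0..t})"
    proof (rule leibniz_rule_field_derivative)
      fix r x assume r: "r \<in> {0..t}"
      have d: "((\<lambda>s. f s x) has_vector_derivative time_deriv f r x) (at r within {0..t})"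
        if "smooth_time_torus f" for f :: "real \<Rightarrow> real ^ 2 \<Rightarrow> real ^ 2"
        by (rule has_vector_derivative_within_subset[OF smooth_has_time_deriv[OF that]]) (use r in auto)
      have "((\<lambda>s. f s x \<bullet> f s x) has_vector_derivative 2 * (f r x \<bullet> time_deriv f r x))
          (at r within {0..t})" if "smooth_time_torus f" for f :: "real \<Rightarrow> real ^ 2 \<Rightarrow> real ^ 2"
        using bounded_bilinear.has_vector_derivative[OF bounded_bilinear_inner d[OF that] d[OF that]]
        by (simp add: inner_commute)
      from has_vector_derivative_add[OF this[OF smooth(1)] this[OF smooth(2)]]
      show "((\<lambda>s. e s x) has_real_derivative e' r x) (at r within {0..t})"
        by (simp add: e_def e'_def has_real_derivative_iff_has_vector_derivative algebra_simps)
    next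
      show "e r integrable_on cell" if "r \<in> {0..t}" for r
        by (rule integrable_continuous[OF e_cont]) (use that in auto)
    next
      show "continuous_on ({0..t} \<times> cell) (\<lambda>(s, x). e' s x)"
        unfolding e'_def case_prod_unfold
        by (intro continuous_intros cont[unfolded case_prod_unfold] cont'[unfolded case_prod_unfold]
            smooth)
    qed (use s in auto)
    show "integral cell (e' s) \<le> 4 * max M1 M2 * integral cell (e s)"
      unfolding e_def[abs_def] e'_def[abs_def]
      by (rule linearized_mhd_energy_bound[where u = "u s" and b = "b s" and v = "v s" and c = "c s"
            and q = "q s" and \<nu> = \<nu> and \<eta> = \<eta>])
        (use s in \<open>auto intro!: smooth_time_torus_periodic_C1 smooth smooth_time_torus_partial div
            continuous_on_slice[OF continuous_on_time_deriv] eq_w eq_h pos bound\<close>)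
  next
    show "integral cell (e 0) = 0"
      by (simp add: e_def[abs_def] init)
  qed (rule t)
  moreover have "integral cell (e t) \<ge> 0"
    by (rule integral_nonneg[OF integrable_continuous[OF e_cont]]) (use t in \<open>auto simp: e_def\<close>)
  ultimately have "integral cell (e t) = 0"
    by simp
  then have zero: "e t x = 0" if "x \<in> cell" for x
    using that t e_cont[of t]
    by (subst (asm) integral_cbox_eq_0_iff) (auto simp: e_def interval_ne_empty_cart)
  obtain y where y: "y \<in> cell" "x \<in> torus_proj y"
    using torus_proj_cell by blast
  have "w t y = 0" "h t y = 0"
    using zero[OF y(1)] by (auto simp: e_def add_nonneg_eq_0_iff)
  then show ?thesis
    using periodic_torus_proj[OF smooth_time_torusD(1)[OF smooth(1)] y(2)]
      periodic_torus_proj[OF smooth_time_torusD(1)[OF smooth(2)] y(2)] t by simp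
qed

text \<open>Splitting the difference with the new velocity \<open>u'\<close> in front and the old field \<open>b\<close> behind leaves
  derivatives of the difference only where it is transported by a divergence free field, and
  otherwise derivatives of the old solution. The energy bound requires exactly this form.\<close>

lemma advect_diff:
  fixes u u' b b' :: "real \<Rightarrow> real ^ 2 \<Rightarrow> real ^ 2"
  assumes "smooth_time_torus b" and "smooth_time_torus b'" and "t \<ge> 0"
  shows "advect (u' t) (b' t) x - advect (u t) (b t) x
    = advect (u' t) (\<lambda>x. b' t x - b t x) x + advect (\<lambda>x. u' t x - u t x) (b t) x"
  unfolding advect_def partial_diff[OF assms(2,1,3)]
  by (simp add: sum.distrib[symmetric] sum_subtractf[symmetric] algebra_simps)

lemma laplacian_diff:
  assumes "smooth_time_torus f" and "smooth_time_torus g" and "t \<ge> 0"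
  shows "laplacian (\<lambda>x. f t x - g t x) x = laplacian (f t) x - laplacian (g t) x"
proof -
  have "partial i (\<lambda>x. partial i (f t) x - partial i (g t) x) x
      = partial i (partial i (f t)) x - partial i (partial i (g t)) x" for i
    using partial_diff[OF assms(1,2)[THEN smooth_time_torus_partial] assms(3), of i i] by metis
  then show ?thesis
    by (simp add: laplacian_def partial_diff[OF assms] sum_subtractf)
qed

lemma divergence_free_diff:
  fixes f g :: "real \<Rightarrow> real ^ 2 \<Rightarrow> real ^ 2"
  assumes "smooth_time_torus f" and "smooth_time_torus g" and "t \<ge> 0"
    and "divergence_free (f t)" and "divergence_free (g t)"
  shows "divergence_free (\<lambda>x. f t x - g t x)"
  using assms(4,5) unfolding divergence_free_def
  by (simp add: divergence_eq smooth_time_torus_periodic_C1 assms(1-3) partial_diff sum_subtractf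
      smooth_time_torus_periodic_C1[OF smooth_time_torus_diff])

theorem mhd_solution_unique:
  assumes sol: "mhd_solution \<nu> \<eta> f1 f2 u0 b0 u b" and sol': "mhd_solution \<nu> \<eta> f1 f2 u0 b0 u' b'"
    and "\<nu> \<ge> 0" and "\<eta> \<ge> 0" and "t \<ge> 0"
  shows "u' t = u t \<and> b' t = b t"
proof -
  from sol obtain P where P: "smooth_time_torus P" "\<And>t x. t \<ge> 0 \<Longrightarrow>
      time_deriv u t x + advect (u t) (u t) x + grad (P t) x
        = \<nu> *\<^sub>R laplacian (u t) x + advect (b t) (b t) x + f1 t x"
    unfolding mhd_solution_def by blast
  from sol' obtain P' where P': "smooth_time_torus P'" "\<And>t x. t \<ge> 0 \<Longrightarrow>
      time_deriv u' t x + advect (u' t) (u' t) x + grad (P' t) x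
        = \<nu> *\<^sub>R laplacian (u' t) x + advect (b' t) (b' t) x + f1 t x"
    unfolding mhd_solution_def by blast
  have smooth: "smooth_time_torus u" "smooth_time_torus b" "smooth_time_torus u'" "smooth_time_torus b'"
    and init: "u 0 = u0" "b 0 = b0" "u' 0 = u0" "b' 0 = b0"
    and div: "\<And>t. t \<ge> 0 \<Longrightarrow> divergence_free (u t)" "\<And>t. t \<ge> 0 \<Longrightarrow> divergence_free (b t)"
      "\<And>t. t \<ge> 0 \<Longrightarrow> divergence_free (u' t)" "\<And>t. t \<ge> 0 \<Longrightarrow> divergence_free (b' t)"
    and ind: "\<And>t x. t \<ge> 0 \<Longrightarrow> time_deriv b t x + advect (u t) (b t) x
        = advect (b t) (u t) x + \<eta> *\<^sub>R laplacian (b t) x + f2 t x"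
    and ind': "\<And>t x. t \<ge> 0 \<Longrightarrow> time_deriv b' t x + advect (u' t) (b' t) x
        = advect (b' t) (u' t) x + \<eta> *\<^sub>R laplacian (b' t) x + f2 t x"
    using sol sol' unfolding mhd_solution_def by auto
  let ?w = "\<lambda>t x. u' t x - u t x"
  let ?h = "\<lambda>t x. b' t x - b t x"
  have "?w t x = 0 \<and> ?h t x = 0" for x
  proof (rule linearized_mhd_trivial[where w = ?w and h = ?h and u = u and b = b and v = u' and c = b'
        and q = "\<lambda>t x. P' t x - P t x" and \<nu> = \<nu> and \<eta> = \<eta>])
    fix t :: real and x assume t: "t \<ge> 0"
    have grad: "grad (\<lambda>x. P' t x - P t x) x = grad (P' t) x - grad (P t) x"
      by (simp add: grad_def partial_diff[OF P'(1) P(1) t] vec_eq_iff)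
    have adv: "advect (u' t) (z' t) x
        = advect (u t) (z t) x + advect (u' t) (\<lambda>x. z' t x - z t x) x + advect (?w t) (z t) x"
      "advect (b' t) (z' t) x
        = advect (b t) (z t) x + advect (b' t) (\<lambda>x. z' t x - z t x) x + advect (?h t) (z t) x"
      if "smooth_time_torus z" "smooth_time_torus z'" for z z'
      using advect_diff[OF that t, where u' = u' and u = u and x = x]
        advect_diff[OF that t, where u' = b' and u = b and x = x]
      by (simp_all add: algebra_simps)
    have dt: "time_deriv u t x
        = \<nu> *\<^sub>R laplacian (u t) x + advect (b t) (b t) x + f1 t x - advect (u t) (u t) x - grad (P t) x"
      "time_deriv u' t x
        = \<nu> *\<^sub>R laplacian (u' t) x + advect (b' t) (b' t) x + f1 t x - advect (u' t) (u' t) x - grad (P' t) x"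
      "time_deriv b t x
        = advect (b t) (u t) x + \<eta> *\<^sub>R laplacian (b t) x + f2 t x - advect (u t) (b t) x"
      "time_deriv b' t x
        = advect (b' t) (u' t) x + \<eta> *\<^sub>R laplacian (b' t) x + f2 t x - advect (u' t) (b' t) x"
      using P(2)[OF t, of x] P'(2)[OF t, of x] ind[OF t, of x] ind'[OF t, of x]
      by (simp_all add: eq_diff_eq add_ac)
    show "time_deriv ?w t x + advect (u' t) (?w t) x + advect (?w t) (u t) x
        + grad (\<lambda>x. P' t x - P t x) x
        = \<nu> *\<^sub>R laplacian (?w t) x + advect (b' t) (?h t) x + advect (?h t) (b t) x"
      unfolding time_deriv_diff[OF smooth(3,1) t] laplacian_diff[OF smooth(3,1) t] grad dt
        adv(1)[OF smooth(1,3)] adv(2)[OF smooth(2,4)]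
      by (simp add: algebra_simps)
    show "time_deriv ?h t x + advect (u' t) (?h t) x + advect (?w t) (b t) x
        = \<eta> *\<^sub>R laplacian (?h t) x + advect (b' t) (?w t) x + advect (?h t) (u t) x"
      unfolding time_deriv_diff[OF smooth(4,2) t] laplacian_diff[OF smooth(4,2) t] dt
        adv(1)[OF smooth(2,4)] adv(2)[OF smooth(1,3)]
      by (simp add: algebra_simps)
  qed (use assms(3-5) smooth P(1) P'(1) div init in
      \<open>auto intro!: smooth_time_torus_diff divergence_free_diff\<close>)
  then show ?thesis
    by (auto simp: fun_eq_iff)
qed

section \<open>A cellular magnetic field in equilibrium\<close>

lemma C_k_on_slice:
  assumes "C_k_on k ({0..} \<times> UNIV) f" and "t \<ge> (0 :: real)"
  shows "C_k_on k UNIV (\<lambda>x. f (t, x))"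
  using assms(1)
proof (induction k arbitrary: f)
  case 0
  then show ?case
    using continuous_on_slice[of "curry f" t UNIV] assms(2) by (simp add: curry_def)
next
  case (Suc k)
  then obtain f' where f': "\<And>p. p \<in> {0..} \<times> UNIV \<Longrightarrow> (f has_derivative f' p) (at p within {0..} \<times> UNIV)"
      "\<And>v. C_k_on k ({0..} \<times> UNIV) (\<lambda>p. f' p v)"
    unfolding C_k_on.simps by blast
  have "((\<lambda>x. f (t, x)) has_derivative (\<lambda>v. f' (t, x) (0, v))) (at x)" for x
  proof (rule has_derivative_in_compose[where g = f])
    show "((\<lambda>x. (t, x)) has_derivative (\<lambda>v. (0, v))) (at x)"
      by (auto intro!: derivative_eq_intros)
    show "(f has_derivative f' (t, x)) (at (t, x) within range (Pair t))"
      by (rule has_derivative_subset[OF f'(1)]) (use assms(2) in auto)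
  qed
  moreover have "C_k_on k UNIV (\<lambda>x. f' (t, x) (0, v))" for v
    by (rule Suc.IH[OF f'(2)])
  ultimately show ?case
    unfolding C_k_on.simps by (intro exI[of _ "\<lambda>x v. f' (t, x) (0, v)"]) blast
qed

lemma smooth_torus_slice:
  assumes "smooth_time_torus f" and "t \<ge> 0"
  shows "smooth_torus (f t)"
  using assms C_k_on_slice[where f = "\<lambda>(t, x). f t x"]
  by (auto simp: smooth_torus_def smooth_time_torus_def smooth_on_def)

lemma smooth_time_torus_const: "smooth_time_torus (\<lambda>t x. c)"
  by (simp add: smooth_time_torus_def smooth_on_def periodic_def case_prod_unfold C_k_on_const)

lemma smooth_time_torus_wave:
  fixes a b c d :: "'b::real_normed_vector" and m :: "real ^ 2"
  assumes "\<And>i. m $ i \<in> \<int>"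
  shows "smooth_time_torus
    (\<lambda>t x. sin (m \<bullet> x) *\<^sub>R (a + t *\<^sub>R b) + cos (m \<bullet> x) *\<^sub>R (c + t *\<^sub>R d))"
proof -
  have "sin (m \<bullet> (x + axis i (2 * pi))) = sin (m \<bullet> x) \<and>
      cos (m \<bullet> (x + axis i (2 * pi))) = cos (m \<bullet> x)" for x i
  proof -
    obtain n where "m $ i = of_int n"
      using assms Ints_cases by blast
    then have "m \<bullet> (x + axis i (2 * pi)) = m \<bullet> x + 2 * pi * of_int n"
      by (simp add: inner_add_right inner_axis)
    then show ?thesis
      by (simp add: sin_add cos_add)
  qed
  then show ?thesis
    unfolding smooth_time_torus_def smooth_on_def periodic_def using C_k_on_wave by auto
qed

text \<open>The field with stream function \<open>q cos x\<^sub>1 - p cos x\<^sub>2\<close>: a shear for \<open>q = 0\<close>, and a pattern of islands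
  when both amplitudes are nonzero.\<close>

definition cellular :: "real \<Rightarrow> real \<Rightarrow> real ^ 2 \<Rightarrow> real ^ 2" where
  "cellular p q x = (p * sin (x $ 2)) *\<^sub>R axis 1 1 + (q * sin (x $ 1)) *\<^sub>R axis 2 1"

lemma cellular_nth [simp]:
  "cellular p q x $ 1 = p * sin (x $ 2)" "cellular p q x $ 2 = q * sin (x $ 1)"
  by (simp_all add: cellular_def axis_def)

lemma smooth_cellular: "smooth_time_torus (\<lambda>t. cellular (p + t * p') (q + t * q'))"
proof -
  have "axis i (1::real) $ j \<in> \<int>" for i j :: 2
    by (simp add: axis_def)
  note wave = smooth_time_torus_wave[where m = "axis _ 1" and c = 0 and d = 0, OF this]
  have "smooth_time_torus (\<lambda>t x. 1 *\<^sub>R (sin (axis 2 1 \<bullet> x) *\<^sub>R (p *\<^sub>R axis 1 1 + t *\<^sub>R p' *\<^sub>R axis 1 1)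
      + cos (axis 2 1 \<bullet> x) *\<^sub>R (0 + t *\<^sub>R 0))
    + 1 *\<^sub>R (sin (axis 1 1 \<bullet> x) *\<^sub>R (q *\<^sub>R axis 2 1 + t *\<^sub>R q' *\<^sub>R axis 2 (1::real))
      + cos (axis 1 1 \<bullet> x) *\<^sub>R (0 + t *\<^sub>R 0)))"
    by (rule smooth_time_torus_lincomb[OF wave wave])
  then show ?thesis
    by (simp add: cellular_def[abs_def] inner_axis' algebra_simps)
qed

lemma partial_cellular:
  "partial 1 (cellular p q) = (\<lambda>x. (q * cos (x $ 1)) *\<^sub>R axis 2 1)"
  "partial 2 (cellular p q) = (\<lambda>x. (p * cos (x $ 2)) *\<^sub>R axis 1 1)"
  unfolding partial_def[abs_def] cellular_def[abs_def]
  by (intro ext vector_derivative_at;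
      auto simp: has_vector_derivative_def axis_def intro!: derivative_eq_intros)+

lemma laplacian_cellular: "laplacian (cellular p q) x = cellular (- p) (- q) x"
proof -
  have "partial 1 (\<lambda>x. (q * cos (x $ 1)) *\<^sub>R (axis 2 1 :: real ^ 2)) x = (- q * sin (x $ 1)) *\<^sub>R axis 2 1"
    "partial 2 (\<lambda>x. (p * cos (x $ 2)) *\<^sub>R (axis 1 1 :: real ^ 2)) x = (- p * sin (x $ 2)) *\<^sub>R axis 1 1"
    unfolding partial_def
    by (intro vector_derivative_at;
        auto simp: has_vector_derivative_def axis_def intro!: derivative_eq_intros)+
  then show ?thesis
    by (simp add: laplacian_def sum_2 partial_cellular cellular_def)
qed

lemma divergence_free_cellular: "divergence_free (cellular p q)"
proof -
  have "partial 1 (\<lambda>y. p * sin (y $ 2)) x = 0" "partial 2 (\<lambda>y. q * sin (y $ 1)) x = 0" for x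
    unfolding partial_def by (simp_all add: axis_def)
  then show ?thesis
    by (simp add: divergence_free_def divergence_def sum_2)
qed

lemma zero_average_cellular: "zero_average (cellular p q)"
proof -
  have "((\<lambda>x. sin (x $ i) *\<^sub>R v) has_integral 0) cell" for i and v :: "real ^ 2"
  proof -
    have "integral cell (\<lambda>x. sin (x $ i) *\<^sub>R v) = 0"
      by (rule integral_cell_derivative_zero[where f = "\<lambda>x. (- cos (x $ i)) *\<^sub>R v" and i = i])
        (auto simp: periodic_def axis_def has_vector_derivative_def
          intro!: continuous_intros derivative_eq_intros)
    moreover have "continuous_on cell (\<lambda>x. sin (x $ i) *\<^sub>R v)"
      by (intro continuous_intros)
    ultimately show ?thesis
      using has_integral_cell by metis
  qed
  from has_integral_add[OF this[of 2 "p *\<^sub>R axis 1 1"] this[of 1 "q *\<^sub>R axis 2 1"]]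
  show ?thesis
    by (simp add: zero_average_def cellular_def[abs_def] mult.commute integral_unique)
qed

text \<open>The stream function \<open>\<psi>\<close> satisfies \<open>\<Delta>\<psi> = - \<psi>\<close>, so that the Lorentz force of the field \<open>b\<close> is the
  gradient of \<open>(|b|\<^sup>2 + \<psi>\<^sup>2) / 2\<close>, which is \<open>- p q cos x\<^sub>1 cos x\<^sub>2\<close> up to a constant.\<close>

lemma advect_cellular:
  "advect (cellular p q) (cellular p q) x = grad (\<lambda>x. - (p * q) * (cos (x $ 1) * cos (x $ 2))) x"
proof -
  have "partial 1 (\<lambda>x. - (p * q) * (cos (x $ 1) * cos (x $ 2))) x = p * q * sin (x $ 1) * cos (x $ 2)"
    "partial 2 (\<lambda>x. - (p * q) * (cos (x $ 1) * cos (x $ 2))) x = p * q * cos (x $ 1) * sin (x $ 2)"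
    unfolding partial_def
    by (intro vector_derivative_at;
        auto simp: has_vector_derivative_def axis_def intro!: derivative_eq_intros)+
  then show ?thesis
    by (simp add: vec_eq_iff forall_2 advect_def sum_2 grad_def partial_cellular axis_def)
qed

text \<open>The product of cosines is written as a sum of two waves, in the directions \<open>(1,1)\<close> and \<open>(1,-1)\<close>.\<close>

lemma smooth_cellular_pressure:
  "smooth_time_torus (\<lambda>t x. - (1 * (0 + t * r)) * (cos (x $ 1) * cos (x $ 2)))"
proof -
  let ?m = "\<lambda>s. axis 1 1 + s *\<^sub>R axis 2 1 :: real ^ 2"
  have "?m s $ i \<in> \<int>" if "s \<in> \<int>" for s i
    using that by (simp add: axis_def)
  note wave = smooth_time_torus_wave[where a = 0 and b = 0 and c = 0 and d = "- r / 2", OF this]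
  have "smooth_time_torus (\<lambda>t x.
      1 *\<^sub>R (sin (?m 1 \<bullet> x) *\<^sub>R (0 + t *\<^sub>R 0)
        + cos (?m 1 \<bullet> x) *\<^sub>R (0 + t *\<^sub>R (- r / 2)))
    + 1 *\<^sub>R (sin (?m (- 1) \<bullet> x) *\<^sub>R (0 + t *\<^sub>R 0)
        + cos (?m (- 1) \<bullet> x) *\<^sub>R (0 + t *\<^sub>R (- r / 2))))"
    by (rule smooth_time_torus_lincomb[OF wave wave]) auto
  then show ?thesis
    by (simp add: inner_add_left inner_diff_left inner_axis' cos_add cos_diff algebra_simps)
qed

section \<open>Stationary points and topological equivalence\<close>

lemma stationary_point_line:
  assumes "v x = 0"
  shows "{torus_proj x} \<in> integral_lines v"
proof -
  have "maximal_integral_curve v UNIV (\<lambda>s. x)"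
    using assms by (auto simp: maximal_integral_curve_def integral_curve_def)
  moreover have "{torus_proj x} = torus_proj ` (\<lambda>s. x) ` (UNIV :: real set)"
    by auto
  ultimately show ?thesis
    unfolding integral_lines_def by blast
qed

text \<open>In the plane the trajectory stays in one coset of the lattice \<open>(2\<pi>\<int>)\<^sup>2\<close>, where \<open>v\<close> is constant. Its
  velocity is read off from \<open>sin (\<gamma>\<^sub>i - x\<^sub>i)\<close>, which vanishes identically although its derivative is
  \<open>v\<^sub>i\<close>. This avoids an appeal to discreteness of the coset.\<close>

lemma singleton_line_stationary:
  assumes "periodic v" and "{torus_proj x} \<in> integral_lines v"
  shows "v x = 0"
proof -
  obtain J \<gamma> where J: "{torus_proj x} = torus_proj ` \<gamma> ` J" and "maximal_integral_curve v J \<gamma>"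
    using assms(2) unfolding integral_lines_def by blast
  then have "integral_curve v J \<gamma>"
    unfolding maximal_integral_curve_def by blast
  then have "open J" "J \<noteq> {}"
    and \<gamma>: "\<And>s. s \<in> J \<Longrightarrow> (\<gamma> has_vector_derivative v (\<gamma> s)) (at s)"
    by (auto simp: integral_curve_def)
  have mem: "\<gamma> s \<in> torus_proj x" if "s \<in> J" for s
  proof -
    have "torus_proj (\<gamma> s) = torus_proj x"
      using J that by auto
    moreover have "\<gamma> s \<in> torus_proj (\<gamma> s)"
      by (auto simp: torus_proj_def intro: exI[of _ 0])
    ultimately show ?thesis by simp
  qed
  obtain s where s: "s \<in> J"
    using \<open>J \<noteq> {}\<close> by blast
  have "v x $ i = 0" for i
  proof -
    have trig: "sin (\<gamma> r $ i - x $ i) = 0" "cos (\<gamma> r $ i - x $ i) = 1" if r: "r \<in> J" for r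
    proof -
      obtain k :: int where "\<gamma> r $ i = x $ i + 2 * pi * of_int k"
        using mem[OF r] by (auto simp: torus_proj_def)
      then show "sin (\<gamma> r $ i - x $ i) = 0" "cos (\<gamma> r $ i - x $ i) = 1"
        by simp_all
    qed
    have "((\<lambda>r. \<gamma> r $ i) has_real_derivative v x $ i) (at s)"
      using bounded_linear.has_vector_derivative[OF bounded_linear_vec_nth \<gamma>[OF s]]
        periodic_torus_proj[OF assms(1) mem[OF s]]
      by (simp add: has_real_derivative_iff_has_vector_derivative)
    then have "((\<lambda>r. sin (\<gamma> r $ i - x $ i)) has_real_derivative v x $ i) (at s)"
      using trig[OF s] by (auto intro!: derivative_eq_intros)
    moreover have "((\<lambda>r. sin (\<gamma> r $ i - x $ i)) has_real_derivative 0) (at s)"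
      by (rule has_field_derivative_transform_within_open[OF DERIV_const \<open>open J\<close> s]) (simp add: trig)
    ultimately show ?thesis
      by (rule DERIV_unique)
  qed
  then show ?thesis
    by (simp add: vec_eq_iff)
qed

lemma topologically_equivalent_finite_stationary:
  assumes "topologically_equivalent v w" and "periodic w"
    and fin: "finite {torus_proj y |y. w y = 0}"
  shows "finite {torus_proj x |x. v x = 0}"
proof -
  obtain h where h: "homeomorphic_map torus torus h"
    and lines: "\<And>L. L \<in> integral_lines v \<Longrightarrow> h ` L \<in> integral_lines w"
    using assms(1) unfolding topologically_equivalent_def by blast
  have "h (torus_proj x) \<in> {torus_proj y |y. w y = 0}" if "v x = 0" for x
  proof -
    have "h (torus_proj x) \<in> range torus_proj"
      using homeomorphic_imp_surjective_map[OF h] unfolding topspace_torus by blast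
    then obtain y where y: "h (torus_proj x) = torus_proj y"
      by blast
    have "{torus_proj y} \<in> integral_lines w"
      using lines[OF stationary_point_line[of v x, OF that]] y by simp
    then show ?thesis
      using singleton_line_stationary[OF assms(2)] y by blast
  qed
  then have "h ` {torus_proj x |x. v x = 0} \<subseteq> {torus_proj y |y. w y = 0}"
    by blast
  then have "finite (h ` {torus_proj x |x. v x = 0})"
    using fin finite_subset by blast
  moreover have "inj_on h {torus_proj x |x. v x = 0}"
    by (rule inj_on_subset[OF homeomorphic_imp_injective_map[OF h]]) (auto simp: topspace_torus)
  ultimately show ?thesis
    by (rule finite_imageD)
qed

lemma torus_proj_eqI:
  assumes "\<And>i. \<exists>k::int. x $ i = y $ i + 2 * pi * of_int k"
  shows "torus_proj x = torus_proj y"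
proof -
  obtain k :: "2 \<Rightarrow> int" where k: "\<And>i. x $ i = y $ i + 2 * pi * of_int (k i)"
    using assms by metis
  have "(\<exists>j::int. z $ i = x $ i + 2 * pi * of_int j) \<longleftrightarrow> (\<exists>j::int. z $ i = y $ i + 2 * pi * of_int j)"
    for z :: "real ^ 2" and i
  proof
    assume "\<exists>j::int. z $ i = x $ i + 2 * pi * of_int j"
    then obtain j :: int where "z $ i = x $ i + 2 * pi * of_int j" ..
    then have "z $ i = y $ i + 2 * pi * of_int (k i + j)"
      by (simp add: k algebra_simps)
    then show "\<exists>j::int. z $ i = y $ i + 2 * pi * of_int j" ..
  next
    assume "\<exists>j::int. z $ i = y $ i + 2 * pi * of_int j"
    then obtain j :: int where "z $ i = y $ i + 2 * pi * of_int j" ..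
    then have "z $ i = x $ i + 2 * pi * of_int (j - k i)"
      by (simp add: k algebra_simps)
    then show "\<exists>j::int. z $ i = x $ i + 2 * pi * of_int j" ..
  qed
  then show ?thesis
    by (simp add: torus_proj_def)
qed

lemma finite_stationary_cellular:
  assumes "p \<noteq> 0" and "q \<noteq> 0"
  shows "finite {torus_proj x |x. cellular p q x = 0}"
proof (rule finite_subset)
  show "{torus_proj x |x. cellular p q x = 0} \<subseteq> (\<lambda>f. torus_proj (\<chi> i. f i)) ` (UNIV \<rightarrow>\<^sub>E {0, pi})"
  proof clarify
    fix x assume "cellular p q x = 0"
    then have "p * sin (x $ 2) = 0" "q * sin (x $ 1) = 0"
      by (metis cellular_nth zero_index)+
    then have "\<forall>i. sin (x $ i) = 0"
      using assms by (simp add: forall_2)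
    then obtain k :: "2 \<Rightarrow> int" where k: "\<And>i. x $ i = of_int (k i) * pi"
      unfolding sin_zero_iff_int2 by metis
    \<comment> \<open>modulo \<open>2\<pi>\<close> each coordinate is \<open>0\<close> or \<open>\<pi>\<close>, by the parity of \<open>k i\<close>\<close>
    let ?f = "\<lambda>i. of_int (k i mod 2) * pi"
    have "torus_proj x = torus_proj (\<chi> i. ?f i)"
    proof (rule torus_proj_eqI)
      fix i
      have "of_int (k i) = (of_int (k i mod 2) + 2 * of_int (k i div 2) :: real)"
        by (metis add.commute mult_div_mod_eq of_int_add of_int_mult of_int_numeral)
      then have "x $ i = (\<chi> i. ?f i) $ i + 2 * pi * of_int (k i div 2)"
        by (simp add: k algebra_simps)
      then show "\<exists>j::int. x $ i = (\<chi> i. ?f i) $ i + 2 * pi * of_int j" ..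
    qed
    moreover have "?f i \<in> {0, pi}" for i
      by (cases "even (k i)") (auto simp: odd_iff_mod_2_eq_one)
    ultimately show "torus_proj x \<in> (\<lambda>f. torus_proj (\<chi> i. f i)) ` (UNIV \<rightarrow>\<^sub>E {0, pi})"
      by (intro image_eqI[of _ _ ?f]) auto
  qed
  show "finite ((\<lambda>f. torus_proj (\<chi> i. f i)) ` ((UNIV :: 2 set) \<rightarrow>\<^sub>E {0, pi}))"
    by (intro finite_imageI finite_PiE) auto
qed

lemma infinite_stationary_shear: "infinite {torus_proj x |x. cellular p 0 x = 0}"
proof
  assume "finite {torus_proj x |x. cellular p 0 x = 0}"
  moreover have "(\<lambda>s. torus_proj (axis 1 s)) ` {0..1} \<subseteq> {torus_proj x |x. cellular p 0 x = 0}"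
    by (auto simp: cellular_def axis_def)
  ultimately have "finite ((\<lambda>s. torus_proj (axis 1 s)) ` {0..1})"
    using finite_subset by blast
  moreover have "inj_on (\<lambda>s. torus_proj (axis 1 s)) {0..1}"
  proof
    fix r s :: real assume rs: "r \<in> {0..1}" "s \<in> {0..1}"
      and eq: "torus_proj (axis 1 r) = torus_proj (axis 1 s)"
    have "axis 1 r \<in> torus_proj (axis 1 s)"
      unfolding eq[symmetric] by (auto simp: torus_proj_def intro: exI[of _ 0])
    then have "\<exists>k::int. axis 1 r $ (1 :: 2) = axis 1 s $ (1 :: 2) + 2 * pi * of_int k"
      unfolding torus_proj_def by blast
    then obtain k :: int where k: "r = s + 2 * pi * of_int k"
      by auto
    have "2 * pi * \<bar>of_int k\<bar> = \<bar>r - s\<bar>"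
      using k by (simp add: abs_mult)
    also have "\<dots> < 2 * pi * 1"
      using rs pi_gt3 by auto
    finally have "\<bar>real_of_int k\<bar> < 1"
      by simp
    then have "k = 0"
      by linarith
    then show "r = s"
      using k by simp
  qed
  ultimately have "finite {0..1::real}"
    by (rule finite_imageD)
  then show False
    using infinite_Icc[of 0 "1::real"] by simp
qed


section \<open>Change of the topology of the magnetic lines\<close>

theorem theorem1p2:
  fixes \<nu> \<eta> T :: real
  assumes "\<nu> > 0" and "\<eta> > 0" and "T > 0"
  shows "\<exists>(b0 :: real ^ 2 \<Rightarrow> real ^ 2)
      (f1 :: real \<Rightarrow> real ^ 2 \<Rightarrow> real ^ 2) (f2 :: real \<Rightarrow> real ^ 2 \<Rightarrow> real ^ 2).
    smooth_torus b0 \<and> zero_average b0 \<and> divergence_free b0 \<and>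
    smooth_time_torus f1 \<and> (\<forall>t\<ge>0. zero_average (f1 t)) \<and>
    smooth_time_torus f2 \<and> (\<forall>t\<ge>0. zero_average (f2 t)) \<and>
    (\<exists>u b. zero_average_mhd_solution \<nu> \<eta> f1 f2 (\<lambda>x. 0) b0 u b \<and>
      (\<forall>u' b'. zero_average_mhd_solution \<nu> \<eta> f1 f2 (\<lambda>x. 0) b0 u' b' \<longrightarrow>
        (\<forall>t\<ge>0. u' t = u t \<and> b' t = b t)) \<and>
      \<not> topologically_equivalent (b 0) (b T))"
proof -
  define b where "b t = cellular 1 (t / T)" for t
  define f2 where "f2 t = cellular \<eta> (1 / T + t * (\<eta> / T))" for t
  let ?z = "\<lambda>(t :: real) (x :: real ^ 2). 0 :: real ^ 2"
  have smooth_b: "smooth_time_torus b"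
    using smooth_cellular[of 1 0 0 "1 / T"] by (simp add: b_def[abs_def])
  have smooth_f2: "smooth_time_torus f2"
    using smooth_cellular[of \<eta> 0 "1 / T" "\<eta> / T"] by (simp add: f2_def[abs_def])
  have zero_average_zero: "zero_average (\<lambda>x. 0)"
    by (simp add: zero_average_def)
  have time_deriv_b: "time_deriv b t x = cellular 0 (1 / T) x" if "t \<ge> 0" for t x
    by (rule has_time_deriv_unique[OF _ that])
      (use \<open>T > 0\<close> in \<open>auto simp: b_def cellular_def has_vector_derivative_def
        intro!: derivative_eq_intros\<close>)
  have zero_field: "partial i (\<lambda>x. 0 :: real ^ 2) = (\<lambda>x. 0)" for i
    by (simp add: partial_def[abs_def])
  have "mhd_solution \<nu> \<eta> ?z f2 (\<lambda>x. 0) (cellular 1 0) ?z b"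
    unfolding mhd_solution_def
  proof (intro conjI exI allI impI)
    \<comment> \<open>the pressure whose gradient is the Lorentz force of \<open>b t\<close>, with amplitudes \<open>1\<close> and \<open>t / T\<close>\<close>
    show "smooth_time_torus (\<lambda>t x. - (1 * (0 + t * (1 / T))) * (cos (x $ 1) * cos (x $ 2)))"
      by (rule smooth_cellular_pressure)
  next
    fix t :: real and x :: "real ^ 2" assume t: "t \<ge> 0"
    show "time_deriv ?z t x + advect (?z t) (?z t) x
        + grad (\<lambda>x. - (1 * (0 + t * (1 / T))) * (cos (x $ 1) * cos (x $ 2))) x
        = \<nu> *\<^sub>R laplacian (?z t) x + advect (b t) (b t) x + ?z t x"
      using advect_cellular[of 1 "t / T" x] has_time_deriv_unique[of ?z x 0 t, OF _ t]
      by (simp add: b_def advect_def[of "\<lambda>x. 0"] laplacian_def zero_field)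
    show "time_deriv b t x + advect (?z t) (b t) x
        = advect (b t) (?z t) x + \<eta> *\<^sub>R laplacian (b t) x + f2 t x"
      by (simp add: time_deriv_b[OF t] advect_def zero_field)
        (use \<open>T > 0\<close> in \<open>simp add: b_def f2_def laplacian_cellular vec_eq_iff forall_2 field_simps\<close>)
    show "divergence_free (?z t)"
      by (simp add: divergence_free_def divergence_def partial_def)
    show "divergence_free (b t)"
      by (simp add: b_def divergence_free_cellular)
  qed (simp_all add: smooth_b smooth_time_torus_const b_def)
  then have sol: "zero_average_mhd_solution \<nu> \<eta> ?z f2 (\<lambda>x. 0) (cellular 1 0) ?z b"
    by (simp add: zero_average_mhd_solution_def zero_average_zero b_def zero_average_cellular)
  have unique: "u' t = ?z t" "b' t = b t"
    if "zero_average_mhd_solution \<nu> \<eta> ?z f2 (\<lambda>x. 0) (cellular 1 0) u' b'" "t \<ge> 0" for u' b' t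
    using mhd_solution_unique[of \<nu> \<eta> ?z f2 "\<lambda>x. 0" "cellular 1 0" ?z b u' b' t]
      sol that assms(1,2)
    by (simp_all add: zero_average_mhd_solution_def)
  have not_equiv: "\<not> topologically_equivalent (b 0) (b T)"
    using topologically_equivalent_finite_stationary[of "cellular 1 0" "cellular 1 1"]
      infinite_stationary_shear[of 1] finite_stationary_cellular[of 1 1]
      smooth_time_torusD(1)[OF smooth_b, of T] \<open>T > 0\<close>
    by (auto simp: b_def)
  have smooth_b0: "smooth_torus (cellular 1 0)"
    using smooth_torus_slice[OF smooth_b, of 0] by (simp add: b_def)
  have zero_average_f2: "zero_average (f2 t)" for t
    by (simp add: f2_def zero_average_cellular)
  have solution: "\<exists>u b. zero_average_mhd_solution \<nu> \<eta> ?z f2 (\<lambda>x. 0) (cellular 1 0) u b \<and>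
      (\<forall>u' b'. zero_average_mhd_solution \<nu> \<eta> ?z f2 (\<lambda>x. 0) (cellular 1 0) u' b' \<longrightarrow>
        (\<forall>t\<ge>0. u' t = u t \<and> b' t = b t)) \<and>
      \<not> topologically_equivalent (b 0) (b T)"
    by (rule exI[of _ ?z], rule exI[of _ b]) (intro conjI allI impI sol unique not_equiv; assumption)
  show ?thesis
    by (rule exI[of _ "cellular 1 0"], rule exI[of _ ?z], rule exI[of _ f2])
      (intro conjI allI impI smooth_b0 zero_average_cellular divergence_free_cellular
        smooth_time_torus_const zero_average_zero smooth_f2 zero_average_f2 solution)
qed

end
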